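(* Let $F$ be a discrete Morse function on a simplicial complex $L$. Suppose that for every critical simplex $\alpha \in Crit(F)$ a linear ordering $Ord_\alpha$ of its vertices is chosen. Then the pairing $\Delta(F)$ on the barycentric subdivision $\Delta(L)$, constructed from $F$ and the orderings $Ord_\alpha$ as described in the context, is a discrete Morse function on $\Delta(L)$ such that the following hold. 1. The critical simplexes of $\Delta(F)$ are exactly the simplexes $\alpha'$, $\alpha\in Crit(F)$, where $\alpha'$ is the simplex of $\Delta(L)$ whose label is $Ord_\alpha$ (viewed as an ordered partition of the vertex set of $\alpha$ into singletons). That is, every critical $k$-simplex of $F$ contains exactly one critical $k$-simplex of $\Delta(F)$, and this $k$-simplex can be chosen arbitrarily (among the $k$-simplexes of $\Delta(L)$ contained in the given critical $k$-simplex) before constructing $\Delta(F)$. This defines a bijection $Crit(F)\to Crit(\Delta(F))$, $\alpha\mapsto\alpha'$. 2. There exists a natural bijection $Gr(F)\to Gr(\Delta(F))$ that respects the bijection $Crit(F)\to Crit(\Delta(F))$: a gradient path of $F$ leading from $\beta$ to $\alpha$ is sent to a gradient path of $\Delta(F)$ leading from $\beta'$ to $\alpha'$. (Natural means: the inverse bijection is the map that replaces each simplex of a gradient path of $\Delta(F)$ by the simplex of $L$ in whose interior it lies and then deletes consecutive repetitions.)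
   Context: Simplexes are nonempty finite vertex sets. A discrete vector field on a simplicial complex is a set of pairs $(\alpha^p,\beta^{p+1})$ of simplexes (superscripts are dimensions) such that each simplex participates in at most one pair and $\alpha^p$ is a facet of $\beta^{p+1}$ in each pair. A $(p+1)$-path is a finite sequence $\beta_0^{p+1},\alpha_1^p,\beta_1^{p+1},\dots,\alpha_m^p,\beta_m^{p+1},\alpha_{m+1}^p$ such that each $(\alpha_i,\beta_i)$ is a pair, neighbouring simplexes $\alpha,\beta$ satisfy that $\alpha$ is a facet of $\beta$, and $\alpha_i\ne\alpha_{i+1}$. It is closed if $m\ge 1$ and $\alpha_{m+1}=\alpha_1$. A discrete Morse function is a discrete vector field with no closed paths. Critical simplexes are the unpaired ones; $Crit(F)$ is the set of critical simplexes of $F$. A gradient $(p+1)$-path from a critical simplex $\beta^{p+1}$ to a critical simplex $\alpha^p$ is a sequence $\beta^{p+1},\alpha_1^p,\beta_1^{p+1},\dots,\alpha_m^p,\beta_m^{p+1},\alpha^p$ satisfying the same three conditions; $Gr(F)$ is the set of all gradient paths (of all dimensions) of $F$. The barycentric subdivision $\Delta(L)$ is the simplicial complex whose vertices are the simplexes of $L$ and whose simplexes are the chains $s_1\subsetneq s_2\subsetneq\dots\subsetneq s_{k+1}$ of simplexes of $L$. The label of the simplex $\gamma$ given by this chain is the ordered partition $\lambda(\gamma)=(s_1,\ s_2\setminus s_1,\ \dots,\ s_{k+1}\setminus s_k)$ of the set $s_{k+1}$; it determines $\gamma$. The simplex $\gamma$ lies in the interior of the simplex $s_{k+1}$ of $L$,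 i.e. of the simplex whose vertex set is partitioned by $\lambda(\gamma)$. Construction of $\Delta(F)$. Every simplex of $\Delta(L)$ lies in the interior of exactly one simplex of $L$, and is treated as follows. (Non-critical simplexes.) Let $(\alpha^{n-1},\beta^n)\in F$, with vertices numbered so that $\alpha=\{1,\dots,n\}$, $\beta=\{1,\dots,n+1\}$. Let $\gamma$ be a simplex lying in the interior of $\alpha$ or of $\beta$, i.e. $\lambda(\gamma)$ is an ordered partition of $\{1,\dots,n\}$ or $\{1,\dots,n+1\}$. (1) If $\lambda(\gamma)$ is an ordered partition of $\{1,\dots,n\}$, pair $\gamma$ with the simplex whose label is obtained by appending the singleton $\{n+1\}$ at the right end. (2) If $\{n+1\}$ is a singleton block and is the last block, pair $\gamma$ with the simplex whose label is obtained by deleting $\{n+1\}$. (3) If $\{n+1\}$ is a singleton block but not the last one, pair $\gamma$ with the simplex whose label is obtained by uniting $\{n+1\}$ with the block immediately after it. (4) If $n+1$ lies in a non-singleton block $I$, pair $\gamma$ with the simplex whose label is obtained by replacing $I$ by the two consecutive blocks $\{n+1\},\ I\setminus\{n+1\}$. (Critical simplexes.) Let $\alpha^n\in Crit(F)$, with vertices numbered so that $\alpha=\{1,\dots,n+1\}$ and $Ord_\alpha=(n+1,n,\dots,1)$; let $\alpha'$ be the simplex with label $(\{n+1\},\{n\},\dots,\{1\})$. Let $\gamma$ lie in the interior of $\alpha$, and let $i$ be the length of the greatest common suffix of $\lambda(\gamma)$ and $\lambda(\alpha')$ (the largest $i$ such that for every $j\le i$ the $j$-th blocks from the end coincide). (1)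 If $\gamma=\alpha'$, leave it unpaired. (2) Otherwise, if $\{i+1\}$ is a singleton block of $\lambda(\gamma)$, pair $\gamma$ with the simplex whose label is obtained by uniting $\{i+1\}$ with the block immediately after it. (3) Otherwise $i+1$ lies in a non-singleton block $I$; pair $\gamma$ with the simplex whose label is obtained by replacing $I$ by the two consecutive blocks $\{i+1\},\ I\setminus\{i+1\}$. *)

theory Defs
  imports "HOL-Library.Sublist"
begin

section \<open>Discrete Morse functions on simplicial complexes\<close>

definition simplicial_complex :: "'a set set \<Rightarrow> bool" where
  "simplicial_complex K \<longleftrightarrow>
     (\<forall>\<sigma>\<in>K. finite \<sigma> \<and> \<sigma> \<noteq> {}) \<and> (\<forall>\<sigma>\<in>K. \<forall>\<tau>. \<tau> \<subseteq> \<sigma> \<and> \<tau> \<noteq> {} \<longrightarrow> \<tau> \<in> K)"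

definition sdim :: "'a set \<Rightarrow> nat" where
  "sdim \<sigma> = card \<sigma> - 1"

definition facet :: "'a set \<Rightarrow> 'a set \<Rightarrow> bool" where
  "facet \<alpha> \<beta> \<longleftrightarrow> \<alpha> \<subset> \<beta> \<and> sdim \<beta> = sdim \<alpha> + 1"

definition discrete_vector_field :: "'a set set \<Rightarrow> ('a set \<times> 'a set) set \<Rightarrow> bool" where
  "discrete_vector_field K F \<longleftrightarrow>
     F \<subseteq> K \<times> K \<and>
     (\<forall>(\<alpha>, \<beta>)\<in>F. facet \<alpha> \<beta>) \<and>
     (\<forall>p\<in>F. \<forall>q\<in>F. {fst p, snd p} \<inter> {fst q, snd q} \<noteq> {} \<longrightarrow> p = q)"

text \<open>The path \<open>\<beta>\<^sub>0, \<alpha>\<^sub>1, \<beta>\<^sub>1, \<dots>, \<alpha>\<^sub>m, \<beta>\<^sub>m, \<alpha>\<^sub>m\<^sub>+\<^sub>1\<close>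
  is the list \<open>s\<close> of length \<open>2 * m + 2\<close> with \<open>\<beta>\<^sub>i = s ! (2 * i)\<close> and
  \<open>\<alpha>\<^sub>i\<^sub>+\<^sub>1 = s ! (2 * i + 1)\<close>.\<close>

definition is_path :: "'a set set \<Rightarrow> ('a set \<times> 'a set) set \<Rightarrow> nat \<Rightarrow> 'a set list \<Rightarrow> bool" where
  "is_path K F p s \<longleftrightarrow> (\<exists>m. length s = 2 * m + 2 \<and>
     (\<forall>i\<le>m. s ! (2 * i) \<in> K \<and> sdim (s ! (2 * i)) = p + 1 \<and>
             s ! (2 * i + 1) \<in> K \<and> sdim (s ! (2 * i + 1)) = p \<and>
             facet (s ! (2 * i + 1)) (s ! (2 * i))) \<and>
     (\<forall>i<m. (s ! (2 * i + 1), s ! (2 * i + 2)) \<in> F \<and>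
             facet (s ! (2 * i + 1)) (s ! (2 * i + 2)) \<and>
             s ! (2 * i + 1) \<noteq> s ! (2 * i + 3)))"

text \<open>\<open>length s \<ge> 4\<close> says \<open>m \<ge> 1\<close>; the initial simplex \<open>\<beta>\<^sub>0\<close> plays no role in closedness.\<close>

definition is_closed_path :: "'a set set \<Rightarrow> ('a set \<times> 'a set) set \<Rightarrow> nat \<Rightarrow> 'a set list \<Rightarrow> bool" where
  "is_closed_path K F p s \<longleftrightarrow> is_path K F p s \<and> length s \<ge> 4 \<and> last s = s ! 1"

definition discrete_morse :: "'a set set \<Rightarrow> ('a set \<times> 'a set) set \<Rightarrow> bool" where
  "discrete_morse K F \<longleftrightarrow> discrete_vector_field K F \<and> \<not> (\<exists>p s. is_closed_path K F p s)"

definition critical :: "'a set set \<Rightarrow> ('a set \<times> 'a set) set \<Rightarrow> 'a set set" where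
  "critical K F = {\<sigma>\<in>K. \<forall>(\<alpha>, \<beta>)\<in>F. \<sigma> \<noteq> \<alpha> \<and> \<sigma> \<noteq> \<beta>}"

text \<open>A gradient path leads from \<open>hd s\<close> to \<open>last s\<close>.\<close>

definition gradient_paths :: "'a set set \<Rightarrow> ('a set \<times> 'a set) set \<Rightarrow> 'a set list set" where
  "gradient_paths K F =
     {s. (\<exists>p. is_path K F p s) \<and> hd s \<in> critical K F \<and> last s \<in> critical K F}"

section \<open>Barycentric subdivision and labels\<close>

definition sd :: "'v set set \<Rightarrow> 'v set set set" where
  "sd L = {\<gamma>. \<gamma> \<noteq> {} \<and> finite \<gamma> \<and> subset.chain L \<gamma>}"

lemma simplicial_complex_sd: "simplicial_complex (sd L)"
proof -
  have "\<tau> \<in> sd L" if "\<sigma> \<in> sd L" "\<tau> \<subseteq> \<sigma>" "\<tau> \<noteq> {}" for \<sigma> \<tau>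
    using that finite_subset[of \<tau> \<sigma>] unfolding sd_def subset_chain_def by blast
  moreover have "finite \<sigma> \<and> \<sigma> \<noteq> {}" if "\<sigma> \<in> sd L" for \<sigma>
    using that unfolding sd_def by blast
  ultimately show ?thesis unfolding simplicial_complex_def by blast
qed

definition chain_list :: "'v set set \<Rightarrow> 'v set list" where
  "chain_list \<gamma> = (THE cs. sorted_wrt (\<subset>) cs \<and> set cs = \<gamma>)"

lemma chain_list_ex1:
  assumes "\<gamma> \<in> sd L"
  shows "\<exists>!cs. sorted_wrt (\<subset>) cs \<and> set cs = \<gamma>"
proof (rule ex_ex1I)
  have "\<exists>cs. sorted_wrt (\<subset>) cs \<and> set cs = C"
    if "finite C" "\<forall>s\<in>C. \<forall>t\<in>C. s \<subseteq> t \<or> t \<subseteq> s" for C :: "'v set set"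
    using that
  proof (induction "card C" arbitrary: C)
    case 0
    then show ?case by (intro exI[of _ "[]"]) auto
  next
    case (Suc n)
    have "C \<noteq> {}" using Suc.hyps(2) by force
    then obtain m where m: "m \<in> C" "\<forall>b\<in>C. m \<subseteq> b \<longrightarrow> m = b"
      using finite_has_maximal[OF Suc.prems(1)] by blast
    have "n = card (C - {m})" using Suc.hyps(2) Suc.prems(1) m(1) by (metis card_Diff_singleton diff_Suc_1)
    moreover have "finite (C - {m})" using Suc.prems(1) by simp
    moreover have "\<forall>s\<in>C - {m}. \<forall>t\<in>C - {m}. s \<subseteq> t \<or> t \<subseteq> s" using Suc.prems(2) by blast
    ultimately have "\<exists>cs. sorted_wrt (\<subset>) cs \<and> set cs = C - {m}"
      by (rule Suc.hyps(1))
    then obtain cs where cs: "sorted_wrt (\<subset>) cs" "set cs = C - {m}" by blast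
    have *: "x \<subset> m" if "x \<in> C - {m}" for x
    proof -
      have "x \<subseteq> m \<or> m \<subseteq> x" using that m(1) Suc.prems(2) by simp
      then show ?thesis using that m(2) by auto
    qed
    have "sorted_wrt (\<subset>) (cs @ [m])" using cs * by (simp add: sorted_wrt_append)
    moreover have "set (cs @ [m]) = C" using cs(2) m(1) by (simp add: insert_absorb)
    ultimately show ?case by blast
  qed
  then show "\<exists>cs. sorted_wrt (\<subset>) cs \<and> set cs = \<gamma>"
    using assms unfolding sd_def subset_chain_def by blast
next
  have "sorted_wrt (\<subset>) xs \<Longrightarrow> sorted_wrt (\<subset>) ys \<Longrightarrow> set xs = set ys \<Longrightarrow> xs = ys"
    for xs ys :: "'v set list"
  proof (induction xs arbitrary: ys)
    case Nil
    then show ?case by simp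
  next
    case (Cons x xs)
    then obtain y ys' where ys: "ys = y # ys'" by (cases ys) auto
    have "x = y"
    proof (rule ccontr)
      assume "x \<noteq> y"
      have "x \<in> set ys'" "y \<in> set xs"
        using Cons.prems(3) \<open>x \<noteq> y\<close> unfolding ys by (metis list.set_intros(1) set_ConsD)+
      then have "x \<subset> y" "y \<subset> x" using Cons.prems(1,2) unfolding ys by simp_all
      then show False by blast
    qed
    moreover have "x \<notin> set xs" "y \<notin> set ys'" using Cons.prems(1,2) unfolding ys by auto
    ultimately have "set xs = set ys'" using Cons.prems(3) unfolding ys by (simp add: insert_ident)
    moreover have "sorted_wrt (\<subset>) xs" "sorted_wrt (\<subset>) ys'" using Cons.prems(1,2) unfolding ys by simp_all
    ultimately have "xs = ys'" using Cons.IH by blast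
    then show ?case using \<open>x = y\<close> ys by simp
  qed
  then show "cs = ds" if "sorted_wrt (\<subset>) cs \<and> set cs = \<gamma>" "sorted_wrt (\<subset>) ds \<and> set ds = \<gamma>" for cs ds
    using that by blast
qed

text \<open>\<open>carrier_simplex \<gamma>\<close> is the simplex of \<open>L\<close> in whose interior \<open>\<gamma>\<close> lies; as the faces of a simplex
  \<open>\<alpha>\<close> of \<open>L\<close> are its nonempty subsets, \<open>\<gamma>\<close> is contained in \<open>\<alpha>\<close> iff \<open>carrier_simplex \<gamma> \<subseteq> \<alpha>\<close>.\<close>

definition carrier_simplex :: "'v set set \<Rightarrow> 'v set" where
  "carrier_simplex \<gamma> = last (chain_list \<gamma>)"

text \<open>\<open>(s\<^sub>1, s\<^sub>2 - s\<^sub>1, \<dots>, s\<^sub>k\<^sub>+\<^sub>1 - s\<^sub>k)\<close>; the surplus last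
  entry of the second list is discarded by \<open>map2\<close>.\<close>

definition label :: "'v set set \<Rightarrow> 'v set list" where
  "label \<gamma> = map2 (-) (chain_list \<gamma>) ({} # chain_list \<gamma>)"

section \<open>The subdivided field\<close>

definition is_ordering :: "'v set \<Rightarrow> 'v list \<Rightarrow> bool" where
  "is_ordering \<alpha> vs \<longleftrightarrow> distinct vs \<and> set vs = \<alpha>"

definition singletons :: "'v list \<Rightarrow> 'v set list" where
  "singletons vs = map (\<lambda>v. {v}) vs"

text \<open>The simplex \<open>\<alpha>'\<close>.\<close>

definition crit_flag :: "'v set set \<Rightarrow> ('v set \<Rightarrow> 'v list) \<Rightarrow> 'v set \<Rightarrow> 'v set set" where
  "crit_flag L Ord \<alpha> = (THE \<gamma>. \<gamma> \<in> sd L \<and> label \<gamma> = singletons (Ord \<alpha>))"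

definition common_suffix_length :: "'b list \<Rightarrow> 'b list \<Rightarrow> nat" where
  "common_suffix_length xs ys = length (Longest_common_prefix {rev xs, rev ys})"

text \<open>The vertex numbered \<open>i + 1\<close> in the numbering for which \<open>Ord\<^sub>\<alpha> = (n + 1, n, \<dots>, 1)\<close> is
  \<open>rev (Ord \<alpha>) ! i\<close>; the following is this vertex, with \<open>i\<close> the length of the greatest common suffix
  of the labels of \<open>\<gamma>\<close> and \<open>\<alpha>'\<close>.\<close>

definition pivot :: "'v set set \<Rightarrow> ('v set \<Rightarrow> 'v list) \<Rightarrow> 'v set \<Rightarrow> 'v set set \<Rightarrow> 'v" where
  "pivot L Ord \<alpha> \<gamma> =
     rev (Ord \<alpha>) ! common_suffix_length (label \<gamma>) (label (crit_flag L Ord \<alpha>))"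

text \<open>Each rule pairs the given simplex \<open>\<gamma>\<close> with the simplex \<open>\<delta>\<close> described by its label. As the
  dimension of a simplex is one less than the number of blocks of its label, \<open>\<gamma>\<close> is the first
  component in the rules that add a block and the second one in the rules that remove a block.
  Nothing here presupposes that pairing \<open>\<gamma>\<close> with \<open>\<delta>\<close> and treating \<open>\<delta>\<close> by its own rule agree.\<close>

inductive_set sd_field ::
    "'v set set \<Rightarrow> ('v set \<times> 'v set) set \<Rightarrow> ('v set \<Rightarrow> 'v list) \<Rightarrow> ('v set set \<times> 'v set set) set"
  for L F Ord where
  append_apex:
    "\<lbrakk>(\<alpha>, \<beta>) \<in> F; \<beta> - \<alpha> = {v}; \<gamma> \<in> sd L; \<delta> \<in> sd L; carrier_simplex \<gamma> = \<alpha>;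
      label \<delta> = label \<gamma> @ [{v}]\<rbrakk> \<Longrightarrow> (\<gamma>, \<delta>) \<in> sd_field L F Ord"
| delete_apex:
    "\<lbrakk>(\<alpha>, \<beta>) \<in> F; \<beta> - \<alpha> = {v}; \<gamma> \<in> sd L; \<delta> \<in> sd L; carrier_simplex \<gamma> = \<beta>;
      label \<gamma> = xs @ [{v}]; label \<delta> = xs\<rbrakk> \<Longrightarrow> (\<delta>, \<gamma>) \<in> sd_field L F Ord"
| unite_apex:
    "\<lbrakk>(\<alpha>, \<beta>) \<in> F; \<beta> - \<alpha> = {v}; \<gamma> \<in> sd L; \<delta> \<in> sd L; carrier_simplex \<gamma> = \<beta>;
      label \<gamma> = xs @ {v} # J # ys; label \<delta> = xs @ ({v} \<union> J) # ys\<rbrakk>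
     \<Longrightarrow> (\<delta>, \<gamma>) \<in> sd_field L F Ord"
| split_apex:
    "\<lbrakk>(\<alpha>, \<beta>) \<in> F; \<beta> - \<alpha> = {v}; \<gamma> \<in> sd L; \<delta> \<in> sd L; carrier_simplex \<gamma> = \<beta>;
      label \<gamma> = xs @ I # ys; v \<in> I; I \<noteq> {v}; label \<delta> = xs @ {v} # (I - {v}) # ys\<rbrakk>
     \<Longrightarrow> (\<gamma>, \<delta>) \<in> sd_field L F Ord"
| unite_critical:
    "\<lbrakk>\<alpha> \<in> critical L F; \<gamma> \<in> sd L; \<delta> \<in> sd L; carrier_simplex \<gamma> = \<alpha>;
      \<gamma> \<noteq> crit_flag L Ord \<alpha>; v = pivot L Ord \<alpha> \<gamma>;
      label \<gamma> = xs @ {v} # J # ys; label \<delta> = xs @ ({v} \<union> J) # ys\<rbrakk>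
     \<Longrightarrow> (\<delta>, \<gamma>) \<in> sd_field L F Ord"
| split_critical:
    "\<lbrakk>\<alpha> \<in> critical L F; \<gamma> \<in> sd L; \<delta> \<in> sd L; carrier_simplex \<gamma> = \<alpha>;
      \<gamma> \<noteq> crit_flag L Ord \<alpha>; v = pivot L Ord \<alpha> \<gamma>;
      label \<gamma> = xs @ I # ys; v \<in> I; I \<noteq> {v}; label \<delta> = xs @ {v} # (I - {v}) # ys\<rbrakk>
     \<Longrightarrow> (\<gamma>, \<delta>) \<in> sd_field L F Ord"

definition project_path :: "'v set set list \<Rightarrow> 'v set list" where
  "project_path t = remdups_adj (map carrier_simplex t)"

end

theory Submission
  imports Defs
begin

text \<open>A simplex of \<open>sd L\<close> is a chain \<open>\<gamma>\<close> of simplexes of \<open>L\<close>, and it lies in the interior of its largest member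
\<open>\<Union>\<gamma>\<close>. In terms of chains all six pairing rules become a single one. For a vertex \<open>v\<close> let \<open>below v \<gamma>\<close> be
the largest member of \<open>\<gamma>\<close> that does not contain \<open>v\<close> (or \<open>{}\<close>). A rule with distinguished vertex \<open>v\<close>
inserts \<open>insert v (below v \<gamma>)\<close> into \<open>\<gamma>\<close> if this set is not a member, and removes it otherwise. For
\<open>(\<alpha>, \<beta>) \<in> F\<close> the vertex is the one in \<open>\<beta> - \<alpha>\<close>; for critical \<open>\<alpha>\<close> it is the last vertex in \<open>Ord \<alpha>\<close> at
which the label of \<open>\<gamma>\<close> deviates from \<open>Ord \<alpha>\<close>. Neither \<open>below v \<gamma>\<close> nor \<open>v\<close> itself changes when the set
is inserted or removed, so the rule is an involution. This makes the field well defined, and the only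
unpaired chains are those in which no vertex is distinguished, the flags \<open>\<alpha>'\<close>
(\<open>sd_field_sound\<close>, \<open>sd_field_complete\<close>, \<open>critical_sd_field\<close>).

Closed paths are excluded by following carriers. Along a path the carrier rises only from the lower to
the upper member of a pair of \<open>F\<close>, and between two rises it must fall. On a closed path the
falls therefore lose exactly one dimension each, and the carriers trace a closed path of \<open>F\<close>, unless
the carrier is constant. While the carrier stays inside one pair of \<open>F\<close>, \<open>below v \<gamma>\<close> shrinks
strictly; inside a critical simplex either it shrinks or the agreement with \<open>Ord \<alpha>\<close> gets shorter
(\<open>flow_step\<close>).

Gradient paths are compared backwards from their ends. A gradient path of the subdivision only visits full
flags of simplexes (chains with one member in every dimension) and codimension one faces of such flags
(\<open>project_stem\<close>). A face in the interior of the same simplex is contained in exactly two full flags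
of that simplex, so the flag from which the path came is the one that is not the partner of the face
(\<open>full_coface_unique\<close>). A face that is itself a full flag of a facet is extended to a full
flag by adding one simplex of \<open>L\<close>, and this simplex is prescribed by the path in \<open>L\<close>. So a path in \<open>L\<close>
and a full flag of its last simplex determine at most one path above it
(\<open>project_stem_inj\<close>). Running the same steps backwards never gets stuck and, by acyclicity, stops at a
critical flag, so that there is one (\<open>lift_stem\<close>).\<close>

section \<open>Simplexes of the subdivision as chains\<close>

lemma sdD:
  assumes "\<gamma> \<in> sd L"
  shows "\<gamma> \<noteq> {}" and "finite \<gamma>" and "\<gamma> \<subseteq> L"
    and "\<And>s t. s \<in> \<gamma> \<Longrightarrow> t \<in> \<gamma> \<Longrightarrow> s \<subseteq> t \<or> t \<subseteq> s"
  using assms by (auto simp: sd_def subset_chain_def)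

lemma sdI:
  assumes "\<gamma> \<noteq> {}" "finite \<gamma>" "\<gamma> \<subseteq> L" "\<And>s t. s \<in> \<gamma> \<Longrightarrow> t \<in> \<gamma> \<Longrightarrow> s \<subseteq> t \<or> t \<subseteq> s"
  shows "\<gamma> \<in> sd L"
  using assms by (auto simp: sd_def subset_chain_def)

lemma simplexD:
  assumes "simplicial_complex L" "\<sigma> \<in> L"
  shows "finite \<sigma>" and "\<sigma> \<noteq> {}" and "\<And>\<tau>. \<tau> \<subseteq> \<sigma> \<Longrightarrow> \<tau> \<noteq> {} \<Longrightarrow> \<tau> \<in> L"
  using assms unfolding simplicial_complex_def by blast+

lemma sd_Diff_singleton: "\<gamma> \<in> sd L \<Longrightarrow> \<gamma> - {s} \<noteq> {} \<Longrightarrow> \<gamma> - {s} \<in> sd L"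
  by (rule simplexD(3)[OF simplicial_complex_sd, of \<gamma>]) auto

lemma Union_in_sd:
  assumes "\<gamma> \<in> sd L"
  shows "\<Union>\<gamma> \<in> \<gamma>"
proof -
  obtain m where m: "m \<in> \<gamma>" "\<forall>b\<in>\<gamma>. m \<subseteq> b \<longrightarrow> m = b"
    using finite_has_maximal[OF sdD(2,1)[OF assms]] by blast
  then have "\<Union>\<gamma> = m" using sdD(4)[OF assms] by blast
  with m show ?thesis by simp
qed

lemma Union_sd_in_complex: "\<gamma> \<in> sd L \<Longrightarrow> \<Union>\<gamma> \<in> L"
  using Union_in_sd sdD(3) by blast

lemma facet_iff:
  assumes "finite \<alpha>" "\<alpha> \<noteq> {}"
  shows "facet \<alpha> \<beta> \<longleftrightarrow> (\<exists>s. s \<notin> \<alpha> \<and> \<beta> = insert s \<alpha>)"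
proof
  assume f: "facet \<alpha> \<beta>"
  have "card \<alpha> \<noteq> 0" using assms by simp
  then have c: "card \<beta> = Suc (card \<alpha>)" using f unfolding facet_def sdim_def by linarith
  then have "finite \<beta>" using card.infinite by fastforce
  then have "card (\<beta> - \<alpha>) = 1" using f c assms(1) by (simp add: facet_def card_Diff_subset psubset_imp_subset)
  then obtain s where "\<beta> - \<alpha> = {s}" using card_1_singletonE by blast
  with f show "\<exists>s. s \<notin> \<alpha> \<and> \<beta> = insert s \<alpha>" unfolding facet_def by blast
next
  assume "\<exists>s. s \<notin> \<alpha> \<and> \<beta> = insert s \<alpha>"
  then have "\<alpha> \<subset> \<beta>" "card \<beta> = Suc (card \<alpha>)" using assms(1) by auto
  moreover have "card \<alpha> > 0" using assms by (simp add: card_gt_0_iff)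
  ultimately show "facet \<alpha> \<beta>" unfolding facet_def sdim_def by linarith
qed

lemma facet_simplex_iff:
  assumes "simplicial_complex K" "\<alpha> \<in> K"
  shows "facet \<alpha> \<beta> \<longleftrightarrow> (\<exists>s. s \<notin> \<alpha> \<and> \<beta> = insert s \<alpha>)"
  using facet_iff simplexD[OF assms] by blast

text \<open>The members of a chain have different positive cardinalities.\<close>

lemma card_sd_le:
  assumes "simplicial_complex L" "\<gamma> \<in> sd L"
  shows "card \<gamma> \<le> card (\<Union>\<gamma>)"
proof -
  note fin = simplexD(1)[OF assms(1)]
  have sub: "\<gamma> \<subseteq> L" using sdD(3)[OF assms(2)] .
  have U: "finite (\<Union>\<gamma>)" using fin[OF Union_sd_in_complex[OF assms(2)]] .
  have "inj_on card \<gamma>"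
  proof (rule inj_onI)
    fix s t assume st: "s \<in> \<gamma>" "t \<in> \<gamma>" "card s = card t"
    then have "finite s" "finite t" using sub fin by blast+
    then show "s = t" using sdD(4)[OF assms(2) st(1,2)] st(3) by (metis card_subset_eq)
  qed
  moreover have "card ` \<gamma> \<subseteq> {1..card (\<Union>\<gamma>)}"
  proof
    fix n assume "n \<in> card ` \<gamma>"
    then obtain s where s: "s \<in> \<gamma>" "n = card s" by blast
    then have "s \<noteq> {}" "finite s" using sub simplexD[OF assms(1)] by blast+
    moreover have "card s \<le> card (\<Union>\<gamma>)" using s U by (intro card_mono) auto
    ultimately show "n \<in> {1..card (\<Union>\<gamma>)}" using s by (simp add: Suc_le_eq card_gt_0_iff)
  qed
  ultimately show ?thesis using card_inj_on_le[of card \<gamma> "{1..card (\<Union>\<gamma>)}"] by simp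
qed

text \<open>On a chain this is the largest member without \<open>v\<close>, or \<open>{}\<close> if every member contains \<open>v\<close>. In the label
it is the union of the blocks to the left of the block of \<open>v\<close>, which makes \<open>insert v (below v \<gamma>)\<close> the
member that is gained by splitting \<open>{v}\<close> off at the left of its block.\<close>

definition below :: "'v \<Rightarrow> 'v set set \<Rightarrow> 'v set" where
  "below v \<gamma> = \<Union>{s\<in>\<gamma>. v \<notin> s}"

lemma notin_below [simp]: "v \<notin> below v \<gamma>"
  by (simp add: below_def)

lemma below_upper: "s \<in> \<gamma> \<Longrightarrow> v \<notin> s \<Longrightarrow> s \<subseteq> below v \<gamma>"
  by (auto simp: below_def)

lemma below_subset_Union: "below v \<gamma> \<subseteq> \<Union>\<gamma>"
  by (auto simp: below_def)

lemma below_mono: "\<gamma> \<subseteq> \<delta> \<Longrightarrow> below v \<gamma> \<subseteq> below v \<delta>"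
  by (auto simp: below_def)

lemma below_eq_Union: "v \<notin> \<Union>\<gamma> \<Longrightarrow> below v \<gamma> = \<Union>\<gamma>"
  by (auto simp: below_def)

lemma below_insert [simp]: "v \<in> s \<Longrightarrow> below v (insert s \<gamma>) = below v \<gamma>"
  by (auto simp: below_def)

lemma below_Diff [simp]: "v \<in> s \<Longrightarrow> below v (\<gamma> - {s}) = below v \<gamma>"
  by (auto simp: below_def)

lemma below_lower:
  assumes "\<gamma> \<in> sd L" "s \<in> \<gamma>" "v \<in> s"
  shows "below v \<gamma> \<subseteq> s"
  using assms sdD(4)[OF assms(1,2)] by (fastforce simp: below_def)

text \<open>The members that do not contain \<open>v\<close> form a chain, whose union is its largest member.\<close>

lemma below_cases:
  assumes "\<gamma> \<in> sd L"
  shows "below v \<gamma> = {} \<or> below v \<gamma> \<in> \<gamma>"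
proof (cases "{s\<in>\<gamma>. v \<notin> s} = {}")
  case False
  then have "{s\<in>\<gamma>. v \<notin> s} \<in> sd L"
    using simplexD(3)[OF simplicial_complex_sd assms] by auto
  then show ?thesis using Union_in_sd unfolding below_def by blast
qed (auto simp: below_def)

text \<open>Members without \<open>v\<close> lie inside \<open>below v \<gamma>\<close>, and members with \<open>v\<close> contain both \<open>below v \<gamma>\<close> and \<open>v\<close>.\<close>

lemma insert_below_in_sd:
  assumes "\<gamma> \<in> sd L" "insert v (below v \<gamma>) \<in> L"
  shows "insert (insert v (below v \<gamma>)) \<gamma> \<in> sd L"
proof (rule sdI)
  show "insert (insert v (below v \<gamma>)) \<gamma> \<subseteq> L" using assms sdD(3) by blast
  have *: "s \<subseteq> insert v (below v \<gamma>) \<or> insert v (below v \<gamma>) \<subseteq> s" if "s \<in> \<gamma>" for s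
    using below_upper[OF that, of v] below_lower[OF assms(1) that, of v] by blast
  show "s \<subseteq> t \<or> t \<subseteq> s"
    if "s \<in> insert (insert v (below v \<gamma>)) \<gamma>" "t \<in> insert (insert v (below v \<gamma>)) \<gamma>" for s t
    using that * sdD(4)[OF assms(1)] by blast
qed (use sdD(2)[OF assms(1)] in auto)

lemma insert_below_in_complex:
  assumes "simplicial_complex L" "\<gamma> \<in> sd L" "v \<in> \<Union>\<gamma>"
  shows "insert v (below v \<gamma>) \<in> L"
  using simplexD(3)[OF assms(1) Union_sd_in_complex[OF assms(2)], of "insert v (below v \<gamma>)"] assms(3)
    below_subset_Union[of v \<gamma>] by blast

text \<open>The top-dimensional simplexes in the subdivision of \<open>\<Union>\<gamma>\<close>, that is, the complete flags of \<open>\<Union>\<gamma>\<close>.\<close>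

definition full :: "'v set set \<Rightarrow> bool" where
  "full \<gamma> \<longleftrightarrow> card \<gamma> = card (\<Union>\<gamma>)"

text \<open>A chain that has as many members as its carrier has vertices cannot be refined, so the set that would
refine it is already there.\<close>

lemma full_mem:
  assumes "simplicial_complex L" "\<gamma> \<in> sd L" "full \<gamma>" "v \<in> \<Union>\<gamma>"
  shows "insert v (below v \<gamma>) \<in> \<gamma>"
proof (rule ccontr)
  let ?\<delta> = "insert (insert v (below v \<gamma>)) \<gamma>"
  assume "insert v (below v \<gamma>) \<notin> \<gamma>"
  then have "card ?\<delta> = Suc (card \<gamma>)" using sdD(2)[OF assms(2)] by simp
  moreover have "?\<delta> \<in> sd L"
    using insert_below_in_sd[OF assms(2) insert_below_in_complex[OF assms(1,2,4)]] .
  then have "card ?\<delta> \<le> card (\<Union>?\<delta>)" using card_sd_le[OF assms(1)] by blast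
  moreover have "\<Union>?\<delta> = \<Union>\<gamma>" using assms(4) below_subset_Union[of v \<gamma>] by blast
  ultimately show False using assms(3) unfolding full_def by simp
qed

section \<open>Labels as ordered partitions\<close>

text \<open>Recovers the chain from its label; the argument \<open>A\<close> collects the blocks that were already passed.\<close>

fun partial_unions :: "'v set \<Rightarrow> 'v set list \<Rightarrow> 'v set list" where
  "partial_unions A [] = []"
| "partial_unions A (b # bs) = (A \<union> b) # partial_unions (A \<union> b) bs"

text \<open>The lists that are labels: ordered partitions, here of a set disjoint from \<open>A\<close>.\<close>

fun disjoint_blocks :: "'v set \<Rightarrow> 'v set list \<Rightarrow> bool" where
  "disjoint_blocks A [] \<longleftrightarrow> True"
| "disjoint_blocks A (b # bs) \<longleftrightarrow> b \<noteq> {} \<and> b \<inter> A = {} \<and> disjoint_blocks (A \<union> b) bs"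

lemma partial_unions_append:
  "partial_unions A (xs @ ys) = partial_unions A xs @ partial_unions (A \<union> \<Union>(set xs)) ys"
  by (induction xs arbitrary: A) (auto simp: Un_assoc)

lemma disjoint_blocks_append:
  "disjoint_blocks A (xs @ ys) \<longleftrightarrow> disjoint_blocks A xs \<and> disjoint_blocks (A \<union> \<Union>(set xs)) ys"
  by (induction xs arbitrary: A) (auto simp: Un_assoc)

lemma disjoint_blocks_disjnt: "disjoint_blocks A bs \<Longrightarrow> A \<inter> \<Union>(set bs) = {}"
  by (induction bs arbitrary: A) fastforce+

lemma disjoint_blocks_nonempty: "disjoint_blocks A bs \<Longrightarrow> {} \<notin> set bs"
  by (induction bs arbitrary: A) auto

lemma set_partial_unions:
  "set (partial_unions A bs) = {A \<union> \<Union>(set p) |p q. bs = p @ q \<and> p \<noteq> []}"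
proof (induction bs arbitrary: A)
  case (Cons b bs)
  have "{A \<union> \<Union>(set p) |p q. b # bs = p @ q \<and> p \<noteq> []} =
      insert (A \<union> b) {A \<union> b \<union> \<Union>(set p) |p q. bs = p @ q \<and> p \<noteq> []}" (is "?l = ?r")
  proof
    show "?l \<subseteq> ?r"
    proof
      fix s assume "s \<in> ?l"
      then obtain p q where pq: "s = A \<union> \<Union>(set p)" "b # bs = p @ q" "p \<noteq> []" by blast
      then obtain p' where "p = b # p'" "bs = p' @ q" by (cases p) auto
      with pq show "s \<in> ?r" by (cases "p' = []") (auto simp: Un_assoc)
    qed
    show "?r \<subseteq> ?l"
    proof
      fix s assume "s \<in> ?r"
      then consider "s = A \<union> b" | p q where "s = A \<union> b \<union> \<Union>(set p)" "bs = p @ q" by blast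
      then show "s \<in> ?l"
      proof cases
        case 1
        then show ?thesis by (intro CollectI exI[of _ "[b]"] exI[of _ bs]) simp
      next
        case 2
        then show ?thesis by (intro CollectI exI[of _ "b # p"] exI[of _ q]) (simp add: Un_assoc)
      qed
    qed
  qed
  then show ?case using Cons.IH by simp
qed simp

lemma partial_unions_between:
  assumes "s \<in> set (partial_unions A bs)"
  shows "A \<subseteq> s" and "s \<subseteq> A \<union> \<Union>(set bs)"
  using assms unfolding set_partial_unions by auto

lemma last_partial_union_mem:
  "bs \<noteq> [] \<Longrightarrow> A \<union> \<Union>(set bs) \<in> set (partial_unions A bs)"
  unfolding set_partial_unions by (intro CollectI exI[of _ bs] exI[of _ "[]"]) simp

lemma Union_partial_unions: "\<Union>(set (partial_unions {} bs)) = \<Union>(set bs)"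
proof (cases "bs = []")
  case False
  then show ?thesis
    using last_partial_union_mem[of bs "{}"] partial_unions_between(2)[of _ "{}" bs] by auto
qed simp

lemma sorted_partial_unions:
  assumes "disjoint_blocks A bs"
  shows "sorted_wrt (\<subset>) (partial_unions A bs)" and "\<And>s. s \<in> set (partial_unions A bs) \<Longrightarrow> A \<subset> s"
proof -
  have "sorted_wrt (\<subset>) (partial_unions A bs) \<and> (\<forall>s\<in>set (partial_unions A bs). A \<subset> s)"
    using assms
  proof (induction bs arbitrary: A)
    case (Cons b bs)
    then have "A \<subset> A \<union> b" by auto
    then show ?case using Cons.IH[of "A \<union> b"] Cons.prems by auto
  qed simp
  then show "sorted_wrt (\<subset>) (partial_unions A bs)"
    and "\<And>s. s \<in> set (partial_unions A bs) \<Longrightarrow> A \<subset> s" by blast+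
qed

lemma differences_partial_unions:
  "disjoint_blocks A bs \<Longrightarrow> map2 (-) (partial_unions A bs) (A # partial_unions A bs) = bs"
  by (induction bs arbitrary: A) auto

lemma differences_of_sorted:
  assumes "sorted_wrt (\<subset>) (A # cs)"
  shows "partial_unions A (map2 (-) cs (A # cs)) = cs \<and> disjoint_blocks A (map2 (-) cs (A # cs))"
  using assms
proof (induction cs arbitrary: A)
  case (Cons c cs)
  then have "A \<union> c = c" "A \<subset> c" by auto
  then show ?case using Cons.IH[of c] Cons.prems by (auto simp: Un_Diff_cancel)
qed simp

lemma chain_list_sd:
  assumes "\<gamma> \<in> sd L"
  shows "sorted_wrt (\<subset>) (chain_list \<gamma>)" and "set (chain_list \<gamma>) = \<gamma>"
  using theI'[OF chain_list_ex1[OF assms]] unfolding chain_list_def by blast+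

text \<open>The differences of consecutive members telescope back to the members, so the label determines the chain.\<close>

lemma label_sd:
  assumes "simplicial_complex L" "\<gamma> \<in> sd L"
  shows "set (partial_unions {} (label \<gamma>)) = \<gamma>" and "disjoint_blocks {} (label \<gamma>)"
    and "\<Union>(set (label \<gamma>)) = \<Union>\<gamma>"
proof -
  have "c \<noteq> {}" if "c \<in> \<gamma>" for c using that sdD(3)[OF assms(2)] simplexD(2)[OF assms(1)] by blast
  then have "sorted_wrt (\<subset>) ({} # chain_list \<gamma>)" using chain_list_sd[OF assms(2)] by auto
  from differences_of_sorted[OF this]
  show *: "set (partial_unions {} (label \<gamma>)) = \<gamma>" "disjoint_blocks {} (label \<gamma>)"
    unfolding label_def using chain_list_sd(2)[OF assms(2)] by auto
  show "\<Union>(set (label \<gamma>)) = \<Union>\<gamma>" using Union_partial_unions[of "label \<gamma>"] * by simp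
qed

lemma carrier_simplex_sd:
  assumes "\<gamma> \<in> sd L"
  shows "carrier_simplex \<gamma> = \<Union>\<gamma>"
proof -
  note cs = chain_list_sd[OF assms]
  have "chain_list \<gamma> \<noteq> []" using cs(2) sdD(1)[OF assms] by auto
  then obtain xs m where m: "chain_list \<gamma> = xs @ [m]" by (metis rev_exhaust)
  then have "\<forall>s\<in>set xs. s \<subset> m" using cs(1) by (simp add: sorted_wrt_append)
  moreover have "\<gamma> = insert m (set xs)" using cs(2) m by simp
  ultimately have "\<Union>\<gamma> = m" by blast
  then show ?thesis using m by (simp add: carrier_simplex_def)
qed

text \<open>Every ordered partition of a simplex of \<open>L\<close> is the label of a simplex of the subdivision. This provides
the partners in the rules, which are specified by their labels only.\<close>

lemma sd_of_blocks:
  assumes "simplicial_complex L" "disjoint_blocks {} bs" "bs \<noteq> []" "\<Union>(set bs) \<in> L"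
  shows "set (partial_unions {} bs) \<in> sd L" and "label (set (partial_unions {} bs)) = bs"
proof -
  let ?cs = "partial_unions {} bs"
  note sorted = sorted_partial_unions[OF assms(2)]
  show sd: "set ?cs \<in> sd L"
  proof (rule sdI)
    show "set ?cs \<noteq> {}" using assms(3) by (cases bs) auto
    show "set ?cs \<subseteq> L"
    proof
      fix s assume "s \<in> set ?cs"
      then have "s \<subseteq> \<Union>(set bs)" "s \<noteq> {}"
        using partial_unions_between(2)[of s "{}" bs] sorted(2)[of s] by auto
      then show "s \<in> L" by (rule simplexD(3)[OF assms(1,4)])
    qed
    show "s \<subseteq> t \<or> t \<subseteq> s" if "s \<in> set ?cs" "t \<in> set ?cs" for s t
      using that unfolding set_partial_unions by (auto simp: append_eq_append_conv2)
  qed simp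
  have "chain_list (set ?cs) = ?cs"
    unfolding chain_list_def using chain_list_ex1[OF sd] sorted(1) by (intro the1_equality) auto
  then show "label (set ?cs) = bs"
    unfolding label_def using differences_partial_unions[OF assms(2)] by simp
qed

lemma below_of_blocks:
  assumes "disjoint_blocks {} (xs @ I # ys)" "v \<in> I"
  shows "below v (set (partial_unions {} (xs @ I # ys))) = \<Union>(set xs)"
proof -
  let ?X = "\<Union>(set xs)"
  have nv: "v \<notin> ?X" using assms by (auto simp: disjoint_blocks_append)
  have "v \<in> s" if "s \<in> set (partial_unions ?X (I # ys))" for s
    using that assms(2) partial_unions_between(1)[of s "?X \<union> I" ys] by auto
  moreover have "v \<notin> s" if "s \<in> set (partial_unions {} xs)" for s
    using that nv partial_unions_between(2)[of s "{}" xs] by auto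
  ultimately have "{s \<in> set (partial_unions {} (xs @ I # ys)). v \<notin> s} = set (partial_unions {} xs)"
    unfolding partial_unions_append set_append by auto
  then show ?thesis unfolding below_def by (simp add: Union_partial_unions)
qed

text \<open>Splitting \<open>{v}\<close> off its block, read as an operation on chains.\<close>

lemma split_block:
  assumes "simplicial_complex L" "\<gamma> \<in> sd L" "\<delta> \<in> sd L" "v \<notin> J"
    and "label \<gamma> = xs @ ({v} \<union> J) # ys" "label \<delta> = xs @ {v} # J # ys"
  shows "\<delta> = insert (insert v (below v \<gamma>)) \<gamma>" and "insert v (below v \<gamma>) \<notin> \<gamma>"
    and "\<Union>\<gamma> = \<Union>\<delta>" and "v \<in> \<Union>\<gamma>"
proof -
  let ?X = "\<Union>(set xs)"
  note g = label_sd[OF assms(1,2), unfolded assms(5)] and d = label_sd[OF assms(1,3), unfolded assms(6)]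
  have b: "below v \<gamma> = ?X" using below_of_blocks[OF g(2)] g(1) by auto
  have J: "J \<noteq> {}" "v \<notin> ?X" "J \<inter> ?X = {}" using d(2) by (auto simp: disjoint_blocks_append)
  have "\<delta> = set (partial_unions {} xs) \<union> insert (insert v ?X) (insert (?X \<union> ({v} \<union> J))
      (set (partial_unions (?X \<union> ({v} \<union> J)) ys)))"
    using d(1) by (auto simp: partial_unions_append Un_assoc)
  moreover have "\<gamma> = set (partial_unions {} xs) \<union> insert (?X \<union> ({v} \<union> J))
      (set (partial_unions (?X \<union> ({v} \<union> J)) ys))"
    using g(1) by (auto simp: partial_unions_append Un_assoc)
  ultimately show "\<delta> = insert (insert v (below v \<gamma>)) \<gamma>" unfolding b by auto
  have "insert v ?X \<notin> set (partial_unions {} xs)"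
    using partial_unions_between(2)[of "insert v ?X" "{}" xs] J by auto
  moreover have "insert v ?X \<noteq> s" if "s \<in> set (partial_unions ?X (({v} \<union> J) # ys))" for s
  proof -
    have "J \<subseteq> s" using that partial_unions_between(1)[of s "?X \<union> ({v} \<union> J)" ys] by auto
    with J assms(4) show ?thesis by blast
  qed
  ultimately show "insert v (below v \<gamma>) \<notin> \<gamma>"
    using g(1) unfolding b partial_unions_append by auto
  show "\<Union>\<gamma> = \<Union>\<delta>" "v \<in> \<Union>\<gamma>" using g(3) d(3) by auto
qed

text \<open>Appending \<open>{v}\<close> is the same operation on chains, as \<open>below v \<gamma> = \<Union>\<gamma>\<close> when \<open>v\<close> does not occur.\<close>

lemma append_block:
  assumes "simplicial_complex L" "\<gamma> \<in> sd L" "\<delta> \<in> sd L" "label \<delta> = label \<gamma> @ [{v}]"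
  shows "\<delta> = insert (insert v (\<Union>\<gamma>)) \<gamma>" and "v \<notin> \<Union>\<gamma>"
proof -
  note g = label_sd[OF assms(1,2)] and d = label_sd[OF assms(1,3), unfolded assms(4)]
  show "v \<notin> \<Union>\<gamma>" using d(2) g(3) by (auto simp: disjoint_blocks_append)
  show "\<delta> = insert (insert v (\<Union>\<gamma>)) \<gamma>"
    using d(1) g(1,3) by (simp add: partial_unions_append insert_commute)
qed

section \<open>Flags and pivots\<close>

text \<open>The chain of the initial segments of \<open>vs\<close>. It has the label \<open>singletons vs\<close>, so that \<open>flag (Ord \<alpha>)\<close>
is \<open>\<alpha>'\<close>.\<close>

definition flag :: "'v list \<Rightarrow> 'v set set" where
  "flag vs = {set p |p q. vs = p @ q \<and> p \<noteq> []}"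

lemma Union_singletons [simp]: "\<Union>(set (singletons vs)) = set vs"
  by (auto simp: singletons_def)

lemma singletons_append: "singletons (xs @ ys) = singletons xs @ singletons ys"
  by (simp add: singletons_def)

lemma flag_eq_partial_unions: "flag vs = set (partial_unions {} (singletons vs))"
proof -
  have "(\<exists>p q. s = set p \<and> vs = p @ q \<and> p \<noteq> []) \<longleftrightarrow>
      (\<exists>p q. s = {} \<union> \<Union>(set p) \<and> singletons vs = p @ q \<and> p \<noteq> [])" (is "?l \<longleftrightarrow> ?r") for s
  proof
    assume ?l
    then obtain p q where "s = set p" "vs = p @ q" "p \<noteq> []" by blast
    then show ?r
      by (intro exI[of _ "singletons p"] exI[of _ "singletons q"]) (auto simp: singletons_append, auto simp: singletons_def)
  next
    assume ?r
    then obtain p q where pq: "s = \<Union>(set p)" "map (\<lambda>v. {v}) vs = p @ q" "p \<noteq> []"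
      unfolding singletons_def by auto
    then obtain p' q' where *: "vs = p' @ q'" "p = singletons p'"
      unfolding map_eq_append_conv singletons_def by blast
    then have "p' \<noteq> []" using pq(3) by (auto simp: singletons_def)
    with * pq(1) show ?l by auto
  qed
  then show ?thesis unfolding flag_def set_partial_unions by blast
qed

lemma disjoint_blocks_singletons: "disjoint_blocks A (singletons vs) \<longleftrightarrow> distinct vs \<and> set vs \<inter> A = {}"
  by (induction vs arbitrary: A) (auto simp: singletons_def)

text \<open>A common suffix of the label of \<open>\<gamma>\<close> and \<open>singletons vs\<close> consisting of \<open>ys\<close> amounts to the membership in \<open>\<gamma>\<close> of
all initial segments of \<open>vs\<close> that reach at least to \<open>v\<close>, the last vertex before \<open>ys\<close>. The suffix is
the greatest one if the next shorter segment \<open>xs\<close> is missing. Requiring \<open>xs\<close> to be nonempty is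
essential: the empty segment is never a member, but it does not count as missing.\<close>

definition is_pivot :: "'v list \<Rightarrow> 'v set set \<Rightarrow> 'v \<Rightarrow> bool" where
  "is_pivot vs \<gamma> v \<longleftrightarrow> (\<exists>xs ys. vs = xs @ v # ys \<and> xs \<noteq> [] \<and> set xs \<notin> \<gamma> \<and>
     (\<forall>p q. ys = p @ q \<longrightarrow> set (xs @ v # p) \<in> \<gamma>))"

lemma is_pivot_unique:
  assumes "is_pivot vs \<gamma> v" "is_pivot vs \<gamma> w"
  shows "v = w"
proof -
  have no: False
    if "set xs' \<notin> \<gamma>" and "\<forall>p q. ys = p @ q \<longrightarrow> set (xs @ v # p) \<in> \<gamma>"
      and "xs @ v # ys = xs' @ w # ys'" and "length xs < length xs'" for xs ys xs' ys' v w
  proof -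
    note t = that
    obtain us where us: "xs' = xs @ us" "us @ w # ys' = v # ys"
      using t(3,4) by (auto simp: append_eq_append_conv2)
    moreover have "us \<noteq> []" using us t(4) by auto
    ultimately obtain p where "us = v # p" by (cases us) auto
    with us t(1,2) show False by auto
  qed
  obtain xs ys where x: "vs = xs @ v # ys" "set xs \<notin> \<gamma>" "\<forall>p q. ys = p @ q \<longrightarrow> set (xs @ v # p) \<in> \<gamma>"
    using assms(1) unfolding is_pivot_def by blast
  obtain xs' ys' where x': "vs = xs' @ w # ys'" "set xs' \<notin> \<gamma>"
      "\<forall>p q. ys' = p @ q \<longrightarrow> set (xs' @ w # p) \<in> \<gamma>"
    using assms(2) unfolding is_pivot_def by blast
  have "xs @ v # ys = xs' @ w # ys'" using x(1) x'(1) by simp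
  moreover from this have "length xs = length xs'"
    using no[OF x'(2) x(3)] no[OF x(2) x'(3)] by (metis linorder_neqE_nat)
  ultimately show ?thesis by simp
qed

lemma is_pivot_not_flag: "is_pivot vs \<gamma> v \<Longrightarrow> \<gamma> \<noteq> flag vs"
  unfolding is_pivot_def flag_def by blast

lemma is_pivot_mem: "is_pivot vs \<gamma> v \<Longrightarrow> v \<in> set vs"
  unfolding is_pivot_def by auto

text \<open>The inserted set contains \<open>v\<close>, so it is not the missing segment. Conversely, removing it could only
spoil the pivot if it were one of the segments that reach to \<open>v\<close>. Then \<open>below v \<gamma>\<close> would be the missing
segment, although it is a member.\<close>

lemma is_pivot_insert_below:
  assumes "\<gamma> \<in> sd L" "distinct vs" "insert v (below v \<gamma>) \<notin> \<gamma>"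
  shows "is_pivot vs (insert (insert v (below v \<gamma>)) \<gamma>) v \<longleftrightarrow> is_pivot vs \<gamma> v"
proof
  let ?\<delta> = "insert (insert v (below v \<gamma>)) \<gamma>"
  assume "is_pivot vs \<gamma> v"
  then obtain xs ys where x: "vs = xs @ v # ys" "xs \<noteq> []" "set xs \<notin> \<gamma>"
      "\<forall>p q. ys = p @ q \<longrightarrow> set (xs @ v # p) \<in> \<gamma>"
    unfolding is_pivot_def by blast
  moreover have "v \<notin> set xs" using assms(2) x(1) by simp
  then have "set xs \<notin> ?\<delta>" using x(3) by auto
  ultimately show "is_pivot vs ?\<delta> v" unfolding is_pivot_def by blast
next
  let ?\<delta> = "insert (insert v (below v \<gamma>)) \<gamma>"
  assume "is_pivot vs ?\<delta> v"
  then obtain xs ys where x: "vs = xs @ v # ys" "xs \<noteq> []" "set xs \<notin> ?\<delta>"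
      "\<forall>p q. ys = p @ q \<longrightarrow> set (xs @ v # p) \<in> ?\<delta>"
    unfolding is_pivot_def by blast
  have vx: "v \<notin> set xs" using assms(2) x(1) by simp
  have mem: "set (xs @ v # p) \<in> \<gamma>" if "ys = p @ q" for p q
  proof (rule ccontr)
    assume n: "set (xs @ v # p) \<notin> \<gamma>"
    then have eq: "set (xs @ v # p) = insert v (below v \<gamma>)" using x(4) that by blast
    have "v \<notin> set p" and "set xs \<inter> set p = {}" using assms(2) x(1) that by auto
    have "v \<notin> set xs \<union> set p" using vx \<open>v \<notin> set p\<close> by simp
    then have b: "below v \<gamma> = set xs \<union> set p"
      using insert_ident[of v "below v \<gamma>" "set xs \<union> set p"] eq by simp
    have "set (xs @ v # []) \<in> ?\<delta>" using x(4) by blast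
    then have "below v \<gamma> \<subseteq> set (xs @ v # [])"
      using below_lower[OF assms(1), of "set (xs @ v # [])" v] by auto
    then have "set p \<subseteq> insert v (set xs)" using b by simp
    moreover have "set p \<inter> insert v (set xs) = {}"
      using \<open>set xs \<inter> set p = {}\<close> \<open>v \<notin> set p\<close> by (simp add: Int_commute)
    ultimately have "set p = {}" using Int_absorb2 by metis
    then have "below v \<gamma> = set xs" using b by simp
    moreover have "set xs \<noteq> {}" using x(2) by simp
    ultimately have "set xs \<in> \<gamma>" using below_cases[OF assms(1), of v] by simp
    with x(3) show False by simp
  qed
  with x(1-3) show "is_pivot vs \<gamma> v" unfolding is_pivot_def by blast
qed

lemma common_suffix_split:
  obtains xs ys zs where "bs = xs @ zs" "cs = ys @ zs" "common_suffix_length bs cs = length zs"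
    and "\<nexists>xs' ys' b. xs = xs' @ [b] \<and> ys = ys' @ [b]"
proof -
  let ?p = "Longest_common_prefix {rev bs, rev cs}"
  have "prefix ?p (rev bs)" "prefix ?p (rev cs)" by (simp_all add: Longest_common_prefix_prefix)
  then obtain us ws where u: "rev bs = ?p @ us" "rev cs = ?p @ ws" by (auto simp: prefix_def)
  have "bs = rev us @ rev ?p" "cs = rev ws @ rev ?p"
    using arg_cong[OF u(1), of rev] arg_cong[OF u(2), of rev] by simp_all
  moreover have False if "rev us = xs' @ [b]" "rev ws = ys' @ [b]" for xs' ys' b
  proof -
    have "us = b # rev xs'" "ws = b # rev ys'" using that by (simp_all add: rev_swap)
    then have "\<forall>xs\<in>{rev bs, rev cs}. prefix (?p @ [b]) xs" using u by (auto simp: prefix_def)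
    then show False using Longest_common_prefix_longest[of "{rev bs, rev cs}" "?p @ [b]"] by simp
  qed
  ultimately show ?thesis using that[of "rev us" "rev ?p" "rev ws"]
    unfolding common_suffix_length_def by auto
qed

text \<open>The vertex selected by the critical rules is the pivot. With \<open>zs\<close> the common suffix, both remaining
prefixes partition the same set, and their last blocks differ. So the last block of the label is not
\<open>{v}\<close>, and the set of the vertices before \<open>v\<close> is not a member of the chain.\<close>

lemma is_pivot_common_suffix:
  assumes "simplicial_complex L" "\<gamma> \<in> sd L" "distinct vs" "\<Union>\<gamma> = set vs" "\<gamma> \<noteq> flag vs"
  shows "is_pivot vs \<gamma> (rev vs ! common_suffix_length (label \<gamma>) (singletons vs))"
proof -
  note lab = label_sd[OF assms(1,2)]
  obtain xs ys zs where s: "label \<gamma> = xs @ zs" "singletons vs = ys @ zs"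
      "common_suffix_length (label \<gamma>) (singletons vs) = length zs"
    and max: "\<nexists>xs' ys' b. xs = xs' @ [b] \<and> ys = ys' @ [b]"
    by (rule common_suffix_split[of "label \<gamma>" "singletons vs"]) blast
  obtain us ws where v: "vs = us @ ws" "ys = singletons us" "zs = singletons ws"
    using s(2) unfolding singletons_def map_eq_append_conv by blast
  have d: "disjoint_blocks {} xs" "disjoint_blocks (\<Union>(set xs)) (singletons ws)"
    using lab(2) unfolding s(1) v(3) by (simp_all add: disjoint_blocks_append)
  have X: "\<Union>(set xs) = set us"
    using lab(3) assms(3,4) disjoint_blocks_disjnt[OF d(2)] unfolding s(1) v by auto
  have "us \<noteq> []"
  proof
    assume "us = []"
    then have "xs = []" using X disjoint_blocks_nonempty[OF d(1)] by (cases xs) auto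
    then have "label \<gamma> = singletons vs" using s(1) v \<open>us = []\<close> by simp
    then show False using lab(1) assms(5) flag_eq_partial_unions by metis
  qed
  then obtain us' v where us: "us = us' @ [v]" by (metis rev_exhaust)
  have v_eq: "rev vs ! common_suffix_length (label \<gamma>) (singletons vs) = v"
  proof -
    have "length zs = length ws" using v(3) by (simp add: singletons_def)
    then show ?thesis unfolding s(3) unfolding v(1) us by (simp add: nth_append)
  qed
  have "v \<in> \<Union>(set xs)" using X us by simp
  then have "xs \<noteq> []" by auto
  then obtain xs' b where xs: "xs = xs' @ [b]" by (metis rev_exhaust)
  have b: "b \<noteq> {v}"
    using max v(2) us xs by (auto simp: singletons_def)
  have g: "\<gamma> = set (partial_unions {} xs') \<union> set (partial_unions (set us) zs) \<union> {set us}"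
  proof -
    have "set (partial_unions {} xs) = set (partial_unions {} xs') \<union> {set us}"
      using X unfolding xs by (simp add: partial_unions_append Un_commute)
    moreover have "\<gamma> = set (partial_unions {} xs) \<union> set (partial_unions (set us) zs)"
      using lab(1) X unfolding s(1) by (simp add: partial_unions_append)
    ultimately show ?thesis by auto
  qed
  have vu: "v \<notin> set us'" using assms(3) v(1) us by simp
  have Xb: "\<Union>(set xs') \<union> b = insert v (set us')" using X unfolding xs us by auto
  have disj: "b \<inter> \<Union>(set xs') = {}" "b \<noteq> {}"
    using d(1) unfolding xs by (auto simp: disjoint_blocks_append)
  have no: False if "set us' \<subseteq> \<Union>(set xs')"
  proof -
    have "b = {v}" using that disj Xb vu by blast
    with b show False by simp
  qed
  have "set us' \<notin> \<gamma>"
  proof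
    assume m: "set us' \<in> \<gamma>"
    have "set us' \<notin> set (partial_unions (set us) zs)"
      using partial_unions_between(1)[of "set us'" "set us" zs] vu us by auto
    moreover have "set us' \<noteq> set us" using vu us by auto
    ultimately have "set us' \<in> set (partial_unions {} xs')" using m g by blast
    then show False using no partial_unions_between(2)[of "set us'" "{}" xs'] by simp
  qed
  moreover have "us' \<noteq> []" using no by auto
  moreover have "set (us' @ v # p) \<in> \<gamma>" if "ws = p @ q" for p q
  proof -
    have "set us \<union> set p \<in> insert (set us) (set (partial_unions (set us) zs))"
    proof (cases "p = []")
      case False
      then have "singletons p \<noteq> []" by (simp add: singletons_def)
      then have "set us \<union> set p \<in> set (partial_unions (set us) (singletons p))"
        using last_partial_union_mem[of "singletons p" "set us"] by simp
      then show ?thesis unfolding v(3) that by (simp add: singletons_append partial_unions_append)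
    qed simp
    then have "set us \<union> set p \<in> \<gamma>" using g by blast
    then show ?thesis using us by (simp add: insert_commute Un_commute Un_left_commute)
  qed
  ultimately show ?thesis unfolding v_eq is_pivot_def using v(1) us by auto
qed

section \<open>The subdivided field as a matching of chains\<close>

locale vector_field_with_orderings =
  fixes L :: "'v set set" and F :: "('v set \<times> 'v set) set" and Ord :: "'v set \<Rightarrow> 'v list"
  assumes complex: "simplicial_complex L"
    and field: "discrete_vector_field L F"
    and ordering: "\<And>\<alpha>. \<alpha> \<in> critical L F \<Longrightarrow> is_ordering \<alpha> (Ord \<alpha>)"
begin

abbreviation V where "V \<equiv> sd_field L F Ord"

lemma pair_mem: "(\<alpha>, \<beta>) \<in> F \<Longrightarrow> \<alpha> \<in> L \<and> \<beta> \<in> L"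
  using field unfolding discrete_vector_field_def by blast

lemma pair_insert:
  assumes "(\<alpha>, \<beta>) \<in> F"
  obtains v where "v \<notin> \<alpha>" "\<beta> = insert v \<alpha>" "\<beta> - \<alpha> = {v}"
proof -
  have "facet \<alpha> \<beta>" using assms field unfolding discrete_vector_field_def by blast
  then obtain v where "v \<notin> \<alpha>" "\<beta> = insert v \<alpha>"
    using facet_simplex_iff[OF complex] pair_mem[OF assms] by blast
  then show thesis using that[of v] by blast
qed

lemma pair_diff:
  assumes "(\<alpha>, \<beta>) \<in> F" "\<beta> - \<alpha> = {v}"
  shows "\<beta> = insert v \<alpha>" and "v \<notin> \<alpha>"
proof -
  obtain w where "w \<notin> \<alpha>" "\<beta> = insert w \<alpha>" "\<beta> - \<alpha> = {w}" using assms(1) by (rule pair_insert)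
  with assms(2) show "\<beta> = insert v \<alpha>" "v \<notin> \<alpha>" by simp_all
qed

lemma pair_unique:
  assumes "(\<alpha>, \<beta>) \<in> F" "(\<alpha>', \<beta>') \<in> F" "\<sigma> \<in> {\<alpha>, \<beta>}" "\<sigma> \<in> {\<alpha>', \<beta>'}"
  shows "\<alpha> = \<alpha>' \<and> \<beta> = \<beta>'"
proof -
  have "{fst (\<alpha>, \<beta>), snd (\<alpha>, \<beta>)} \<inter> {fst (\<alpha>', \<beta>'), snd (\<alpha>', \<beta>')} \<noteq> {}" using assms(3,4) by auto
  then have "(\<alpha>, \<beta>) = (\<alpha>', \<beta>')"
    using field assms(1,2) unfolding discrete_vector_field_def by blast
  then show ?thesis by simp
qed

lemma pair_not_critical: "(\<alpha>, \<beta>) \<in> F \<Longrightarrow> \<alpha> \<notin> critical L F \<and> \<beta> \<notin> critical L F"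
  unfolding critical_def by blast

lemma simplex_cases:
  assumes "\<sigma> \<in> L"
  obtains (lower) \<beta> where "(\<sigma>, \<beta>) \<in> F" | (upper) \<alpha> where "(\<alpha>, \<sigma>) \<in> F" | (crit) "\<sigma> \<in> critical L F"
  using assms unfolding critical_def by blast

lemma ord:
  assumes "\<alpha> \<in> critical L F"
  shows "distinct (Ord \<alpha>)" and "set (Ord \<alpha>) = \<alpha>" and "Ord \<alpha> \<noteq> []" and "\<alpha> \<in> L"
proof -
  show *: "distinct (Ord \<alpha>)" "set (Ord \<alpha>) = \<alpha>" "\<alpha> \<in> L"
    using ordering[OF assms] assms unfolding is_ordering_def critical_def by auto
  show "Ord \<alpha> \<noteq> []" using simplexD(2)[OF complex *(3)] *(2) by auto
qed

lemma crit_flag_eq_flag: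
  assumes "\<alpha> \<in> critical L F"
  shows "crit_flag L Ord \<alpha> = flag (Ord \<alpha>)" and "flag (Ord \<alpha>) \<in> sd L"
    and "label (flag (Ord \<alpha>)) = singletons (Ord \<alpha>)" and "\<Union>(flag (Ord \<alpha>)) = \<alpha>"
proof -
  note o = ord[OF assms]
  have "disjoint_blocks {} (singletons (Ord \<alpha>))" using o by (simp add: disjoint_blocks_singletons)
  moreover have "singletons (Ord \<alpha>) \<noteq> []" using o by (simp add: singletons_def)
  ultimately show *: "flag (Ord \<alpha>) \<in> sd L" "label (flag (Ord \<alpha>)) = singletons (Ord \<alpha>)"
    unfolding flag_eq_partial_unions using sd_of_blocks[OF complex] o by auto
  have "\<gamma> = flag (Ord \<alpha>)" if "\<gamma> \<in> sd L" "label \<gamma> = singletons (Ord \<alpha>)" for \<gamma>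
    using label_sd(1)[OF complex that(1)] that(2) flag_eq_partial_unions[of "Ord \<alpha>"] by simp
  then show "crit_flag L Ord \<alpha> = flag (Ord \<alpha>)"
    unfolding crit_flag_def using * by (intro the_equality conjI) blast+
  show "\<Union>(flag (Ord \<alpha>)) = \<alpha>"
    unfolding flag_eq_partial_unions using Union_partial_unions[of "singletons (Ord \<alpha>)"] o by simp
qed

text \<open>The vertex that is distinguished by the rules that apply to \<open>\<gamma>\<close>.\<close>

definition pivotal :: "'v set set \<Rightarrow> 'v \<Rightarrow> bool" where
  "pivotal \<gamma> v \<longleftrightarrow> (\<exists>\<alpha> \<beta>. (\<alpha>, \<beta>) \<in> F \<and> \<beta> - \<alpha> = {v} \<and> \<Union>\<gamma> \<in> {\<alpha>, \<beta>}) \<or>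
     (\<Union>\<gamma> \<in> critical L F \<and> is_pivot (Ord (\<Union>\<gamma>)) \<gamma> v)"

lemma pivotal_critical:
  "\<Union>\<gamma> \<in> critical L F \<Longrightarrow> pivotal \<gamma> v \<longleftrightarrow> is_pivot (Ord (\<Union>\<gamma>)) \<gamma> v"
  unfolding pivotal_def using pair_not_critical by blast

lemma pivotal_pair:
  assumes "(\<alpha>, \<beta>) \<in> F" "\<Union>\<gamma> \<in> {\<alpha>, \<beta>}"
  shows "pivotal \<gamma> v \<longleftrightarrow> \<beta> - \<alpha> = {v}"
proof -
  have "\<Union>\<gamma> \<notin> critical L F" using assms pair_not_critical by auto
  then show ?thesis unfolding pivotal_def using assms pair_unique by (metis (no_types, lifting))
qed

lemma pivotal_unique:
  assumes "\<gamma> \<in> sd L" "pivotal \<gamma> v" "pivotal \<gamma> w"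
  shows "v = w"
  using Union_sd_in_complex[OF assms(1)]
proof (cases rule: simplex_cases)
  case (lower \<beta>)
  then show ?thesis using pivotal_pair[OF lower, of \<gamma>] assms(2,3) by simp
next
  case (upper \<alpha>)
  then show ?thesis using pivotal_pair[OF upper, of \<gamma>] assms(2,3) by simp
next
  case crit
  then show ?thesis using pivotal_critical[OF crit] assms(2,3) is_pivot_unique by metis
qed

lemma pivotal_exists:
  assumes "\<gamma> \<in> sd L" "\<not> (\<Union>\<gamma> \<in> critical L F \<and> \<gamma> = flag (Ord (\<Union>\<gamma>)))"
  shows "\<exists>v. pivotal \<gamma> v"
  using Union_sd_in_complex[OF assms(1)]
proof (cases rule: simplex_cases)
  case (lower \<beta>)
  then obtain v where "\<beta> - \<Union>\<gamma> = {v}" by (rule pair_insert)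
  with lower show ?thesis using pivotal_pair[OF lower, of \<gamma>] by simp
next
  case (upper \<alpha>)
  then obtain v where "\<Union>\<gamma> - \<alpha> = {v}" by (rule pair_insert)
  with upper show ?thesis using pivotal_pair[OF upper, of \<gamma>] by simp
next
  case crit
  then have "is_pivot (Ord (\<Union>\<gamma>)) \<gamma>
      (rev (Ord (\<Union>\<gamma>)) ! common_suffix_length (label \<gamma>) (singletons (Ord (\<Union>\<gamma>))))"
    using is_pivot_common_suffix[OF complex assms(1) ord(1)[OF crit]] ord(2)[OF crit] assms(2) by simp
  then show ?thesis using pivotal_critical[OF crit] by blast
qed

lemma pivot_iff_is_pivot:
  assumes "\<alpha> \<in> critical L F" "\<gamma> \<in> sd L" "\<Union>\<gamma> = \<alpha>" "\<gamma> \<noteq> flag (Ord \<alpha>)"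
  shows "v = pivot L Ord \<alpha> \<gamma> \<longleftrightarrow> is_pivot (Ord \<alpha>) \<gamma> v"
proof -
  have "is_pivot (Ord \<alpha>) \<gamma> (pivot L Ord \<alpha> \<gamma>)"
    unfolding pivot_def crit_flag_eq_flag(1,3)[OF assms(1)]
    using is_pivot_common_suffix[OF complex assms(2) ord(1)[OF assms(1)]] ord(2)[OF assms(1)] assms(3,4)
    by simp
  then show ?thesis using is_pivot_unique[of "Ord \<alpha>" \<gamma> v "pivot L Ord \<alpha> \<gamma>"] by blast
qed

lemma pivotal_insert_in_complex:
  assumes "\<gamma> \<in> sd L" "pivotal \<gamma> v"
  shows "insert v (below v \<gamma>) \<in> L"
  using Union_sd_in_complex[OF assms(1)]
proof (cases rule: simplex_cases)
  case (lower \<beta>)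
  then have "\<beta> - \<Union>\<gamma> = {v}" using pivotal_pair[OF lower, of \<gamma>] assms(2) by simp
  then have "insert v (below v \<gamma>) = \<beta>"
    using pair_diff[OF lower, of v] below_eq_Union[of v \<gamma>] by simp
  then show ?thesis using lower pair_mem by simp
next
  case (upper \<alpha>)
  then have "\<Union>\<gamma> - \<alpha> = {v}" using pivotal_pair[OF upper, of \<gamma>] assms(2) by simp
  then have "v \<in> \<Union>\<gamma>" by blast
  then show ?thesis using insert_below_in_complex[OF complex assms(1)] by simp
next
  case crit
  then have "is_pivot (Ord (\<Union>\<gamma>)) \<gamma> v" using pivotal_critical[OF crit] assms(2) by simp
  then have "v \<in> \<Union>\<gamma>" using is_pivot_mem ord(2)[OF crit] by fastforce
  then show ?thesis using insert_below_in_complex[OF complex assms(1)] by simp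
qed

text \<open>The rules agree on both members of a pair. If \<open>v\<close> lies in the carrier of \<open>\<gamma>\<close>, the carrier does not change,
and only pivots have to be compared. Otherwise the carrier grows by \<open>v\<close>, which happens exactly from
the lower to the upper member of a pair of \<open>F\<close>: if the new carrier were critical, its initial segment
without \<open>v\<close> would be missing, but it is the old carrier.\<close>

lemma pivotal_insert_below:
  assumes "\<gamma> \<in> sd L" "insert v (below v \<gamma>) \<notin> \<gamma>" "insert (insert v (below v \<gamma>)) \<gamma> \<in> sd L"
  shows "pivotal (insert (insert v (below v \<gamma>)) \<gamma>) v \<longleftrightarrow> pivotal \<gamma> v"
proof (cases "v \<in> \<Union>\<gamma>")
  case True
  then have U: "\<Union>(insert (insert v (below v \<gamma>)) \<gamma>) = \<Union>\<gamma>"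
    using below_subset_Union[of v \<gamma>] by blast
  show ?thesis
  proof (cases "\<Union>\<gamma> \<in> critical L F")
    case True
    then show ?thesis
      using pivotal_critical[of \<gamma>] pivotal_critical[of "insert (insert v (below v \<gamma>)) \<gamma>"] U
        is_pivot_insert_below[OF assms(1) ord(1) assms(2)] by simp
  next
    case False
    then show ?thesis unfolding pivotal_def U by simp
  qed
next
  case False
  then have b: "below v \<gamma> = \<Union>\<gamma>" by (rule below_eq_Union)
  then have U: "\<Union>(insert (insert v (below v \<gamma>)) \<gamma>) = insert v (\<Union>\<gamma>)" by blast
  show ?thesis
  proof
    assume "pivotal \<gamma> v"
    have "\<not> (\<Union>\<gamma> \<in> critical L F \<and> is_pivot (Ord (\<Union>\<gamma>)) \<gamma> v)"
      using False ord(2)[of "\<Union>\<gamma>"] is_pivot_mem[of "Ord (\<Union>\<gamma>)" \<gamma> v] by metis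
    then obtain \<alpha> \<beta> where *: "(\<alpha>, \<beta>) \<in> F" "\<beta> - \<alpha> = {v}" "\<Union>\<gamma> \<in> {\<alpha>, \<beta>}"
      using \<open>pivotal \<gamma> v\<close> unfolding pivotal_def by blast
    note \<beta> = pair_diff[OF *(1,2)]
    have "\<Union>\<gamma> \<noteq> \<beta>" using False \<beta>(1) by blast
    then have "\<beta> = insert v (\<Union>\<gamma>)" using *(3) \<beta>(1) by simp
    then show "pivotal (insert (insert v (below v \<gamma>)) \<gamma>) v"
      unfolding pivotal_def U using * by blast
  next
    assume p: "pivotal (insert (insert v (below v \<gamma>)) \<gamma>) v" (is "pivotal ?\<delta> v")
    show "pivotal \<gamma> v"
    proof (cases "\<exists>\<alpha> \<beta>. (\<alpha>, \<beta>) \<in> F \<and> \<beta> - \<alpha> = {v} \<and> \<Union>?\<delta> \<in> {\<alpha>, \<beta>}")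
      case True
      then obtain \<alpha> \<beta> where *: "(\<alpha>, \<beta>) \<in> F" "\<beta> - \<alpha> = {v}" "\<Union>?\<delta> \<in> {\<alpha>, \<beta>}" by blast
      note \<beta> = pair_diff[OF *(1,2)]
      have "\<Union>?\<delta> \<noteq> \<alpha>" using \<beta>(2) by blast
      then have "insert v (\<Union>\<gamma>) = insert v \<alpha>" using *(3) \<beta>(1) unfolding U by simp
      then have "\<alpha> = \<Union>\<gamma>" using \<beta>(2) False by (simp add: insert_ident del: Union_iff)
      then show ?thesis unfolding pivotal_def using * by blast
    next
      case no_pair: False
      then have c: "\<Union>?\<delta> \<in> critical L F" "is_pivot (Ord (\<Union>?\<delta>)) ?\<delta> v"
        using p unfolding pivotal_def by blast+
      then obtain xs ys where x: "Ord (\<Union>?\<delta>) = xs @ v # ys" "xs \<noteq> []" "set xs \<notin> ?\<delta>"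
          "\<forall>p q. ys = p @ q \<longrightarrow> set (xs @ v # p) \<in> ?\<delta>"
        unfolding is_pivot_def by blast
      have "set (xs @ v # []) \<in> ?\<delta>" using x(4) by blast
      moreover have "set (xs @ v # []) \<notin> \<gamma>" using False by auto
      ultimately have "set (xs @ v # []) = insert v (\<Union>\<gamma>)" using b by simp
      moreover have "v \<notin> set xs" using ord(1)[OF c(1)] x(1) by simp
      ultimately have "set xs = \<Union>\<gamma>" using False by (simp add: insert_ident del: Union_iff)
      then show ?thesis using x(3) Union_in_sd[OF assms(1)] by simp
    qed
  qed
qed

text \<open>Each rule inserts or removes the set determined by the distinguished vertex. The two rules that delete
or unite blocks are the rules that append or split, seen from the partner.\<close>

lemma sd_field_sound:
  assumes "(\<gamma>, \<delta>) \<in> V"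
  shows "\<exists>v. \<gamma> \<in> sd L \<and> \<delta> \<in> sd L \<and> pivotal \<gamma> v \<and> insert v (below v \<gamma>) \<notin> \<gamma> \<and>
    \<delta> = insert (insert v (below v \<gamma>)) \<gamma>"
proof -
  have append: "\<exists>v. \<gamma> \<in> sd L \<and> \<delta> \<in> sd L \<and> pivotal \<gamma> v \<and> insert v (below v \<gamma>) \<notin> \<gamma> \<and>
    \<delta> = insert (insert v (below v \<gamma>)) \<gamma>"
    if "(\<alpha>, \<beta>) \<in> F" "\<beta> - \<alpha> = {v}" "\<gamma> \<in> sd L" "\<delta> \<in> sd L" "\<Union>\<gamma> = \<alpha>"
      "label \<delta> = label \<gamma> @ [{v}]" for \<alpha> \<beta> v \<gamma> \<delta>
  proof -
    note d = append_block[OF complex that(3,4,6)]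
    have "below v \<gamma> = \<Union>\<gamma>" using d(2) by (rule below_eq_Union)
    moreover have "insert v (\<Union>\<gamma>) \<notin> \<gamma>" using d(2) by blast
    moreover have "pivotal \<gamma> v" unfolding pivotal_def using that by blast
    ultimately show ?thesis using d(1) that(3,4) by auto
  qed
  have split: "\<exists>v. \<gamma> \<in> sd L \<and> \<delta> \<in> sd L \<and> pivotal \<gamma> v \<and> insert v (below v \<gamma>) \<notin> \<gamma> \<and>
    \<delta> = insert (insert v (below v \<gamma>)) \<gamma>"
    if "\<gamma> \<in> sd L" "\<delta> \<in> sd L" "v \<notin> J" "label \<gamma> = xs @ ({v} \<union> J) # ys"
      "label \<delta> = xs @ {v} # J # ys" "pivotal \<gamma> v \<or> pivotal \<delta> v" for \<gamma> \<delta> v J xs ys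
  proof -
    note d = split_block[OF complex that(1-5)]
    have "pivotal \<gamma> v" using that(2,6) pivotal_insert_below[OF that(1) d(2)] d(1) by auto
    then show ?thesis using d that(1,2) by blast
  qed
  have vJ: "v \<notin> J" if "\<delta> \<in> sd L" "label \<delta> = xs @ {v} # J # ys" for \<delta> v J xs ys
    using label_sd(2)[OF complex that(1)] that(2) by (auto simp: disjoint_blocks_append)
  show ?thesis
    using assms
  proof cases
    case (append_apex \<alpha> \<beta> v)
    then show ?thesis
      using append[OF append_apex(1-4) _ append_apex(6)] carrier_simplex_sd[OF append_apex(3)] by simp
  next
    case (delete_apex \<alpha> \<beta> v xs)
    then have lab: "label \<delta> = label \<gamma> @ [{v}]" by simp
    note d = append_block[OF complex delete_apex(4,3) lab]
    have "\<Union>\<delta> = \<beta>" using delete_apex(5) carrier_simplex_sd[OF delete_apex(3)] by simp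
    then have "insert v \<alpha> = insert v (\<Union>\<gamma>)"
      using d(1) pair_diff(1)[OF delete_apex(1,2)] by auto
    then have "\<Union>\<gamma> = \<alpha>"
      using pair_diff(2)[OF delete_apex(1,2)] d(2) by (simp add: insert_ident del: Union_iff)
    then show ?thesis using append[OF delete_apex(1,2,4,3) _ lab] by simp
  next
    case (unite_apex \<alpha> \<beta> v xs J ys)
    have "\<Union>\<delta> = \<beta>" using unite_apex(5) carrier_simplex_sd[OF unite_apex(3)] by simp
    then have "pivotal \<delta> v" using pivotal_pair[OF unite_apex(1)] unite_apex(2) by simp
    then show ?thesis
      using split[OF unite_apex(4,3) vJ[OF unite_apex(3,6)] unite_apex(7,6)] by blast
  next
    case (split_apex \<alpha> \<beta> v xs I ys)
    have "\<Union>\<gamma> = \<beta>" using split_apex(5) carrier_simplex_sd[OF split_apex(3)] by simp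
    then have "pivotal \<gamma> v" using pivotal_pair[OF split_apex(1)] split_apex(2) by simp
    moreover have "{v} \<union> (I - {v}) = I" using split_apex(7) by blast
    ultimately show ?thesis
      using split[of \<gamma> \<delta> v "I - {v}" xs ys] split_apex(3,4,6,9) by simp
  next
    case (unite_critical \<alpha> v xs J ys)
    have U: "\<Union>\<delta> = \<alpha>" using unite_critical(4) carrier_simplex_sd[OF unite_critical(2)] by simp
    then have "is_pivot (Ord \<alpha>) \<delta> v"
      using unite_critical(5,6) crit_flag_eq_flag(1)[OF unite_critical(1)]
        pivot_iff_is_pivot[OF unite_critical(1,2) U] by simp
    then have "pivotal \<delta> v" using pivotal_critical[of \<delta>] unite_critical(1) U by simp
    then show ?thesis
      using split[OF unite_critical(3,2) vJ[OF unite_critical(2,7)] unite_critical(8,7)] by blast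
  next
    case (split_critical \<alpha> v xs I ys)
    have U: "\<Union>\<gamma> = \<alpha>" using split_critical(4) carrier_simplex_sd[OF split_critical(2)] by simp
    then have "is_pivot (Ord \<alpha>) \<gamma> v"
      using split_critical(5,6) crit_flag_eq_flag(1)[OF split_critical(1)]
        pivot_iff_is_pivot[OF split_critical(1,2) U] by simp
    then have "pivotal \<gamma> v" using pivotal_critical[of \<gamma>] split_critical(1) U by simp
    moreover have "{v} \<union> (I - {v}) = I" using split_critical(8) by blast
    ultimately show ?thesis
      using split[of \<gamma> \<delta> v "I - {v}" xs ys] split_critical(2,3,7,10) by simp
  qed
qed

text \<open>The pair comes from the rule for its lower member, which splits off \<open>{v}\<close> if \<open>v\<close> lies in the carrier and
appends \<open>{v}\<close> otherwise.\<close>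

lemma sd_field_complete:
  assumes "\<gamma> \<in> sd L" "pivotal \<gamma> v" "insert v (below v \<gamma>) \<notin> \<gamma>"
  shows "(\<gamma>, insert (insert v (below v \<gamma>)) \<gamma>) \<in> V"
proof -
  let ?\<delta> = "insert (insert v (below v \<gamma>)) \<gamma>"
  note lab = label_sd[OF complex assms(1)]
  have sd: "?\<delta> \<in> sd L"
    using insert_below_in_sd[OF assms(1)] pivotal_insert_in_complex[OF assms(1,2)] .
  show ?thesis
  proof (cases "v \<in> \<Union>\<gamma>")
    case True
    then obtain I where "I \<in> set (label \<gamma>)" "v \<in> I" using lab(3) by blast
    then obtain xs ys where l: "label \<gamma> = xs @ I # ys" by (meson split_list)
    have d: "disjoint_blocks {} (xs @ I # ys)" using lab(2) l by simp
    have b: "below v \<gamma> = \<Union>(set xs)" using below_of_blocks[OF d \<open>v \<in> I\<close>] lab(1) l by simp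
    have I: "I \<noteq> {v}"
    proof
      assume "I = {v}"
      then have "insert v (\<Union>(set xs)) \<in> set (partial_unions {} (label \<gamma>))"
        unfolding l by (simp add: partial_unions_append)
      then show False using assms(3) lab(1) b by simp
    qed
    \<comment> \<open>The block of \<open>v\<close> is no singleton, so a splitting rule applies.\<close>
    let ?bs = "xs @ {v} # (I - {v}) # ys"
    have vI: "insert v I = I" using \<open>v \<in> I\<close> by blast
    have "insert v (\<Union>(set xs) \<union> (I - {v})) = \<Union>(set xs) \<union> I" "I - {v} \<noteq> {}"
      using \<open>v \<in> I\<close> I by blast+
    then have "disjoint_blocks {} ?bs" using d \<open>v \<in> I\<close>
      by (auto simp: disjoint_blocks_append)
    moreover have "\<Union>(set ?bs) = \<Union>(set (xs @ I # ys))" using \<open>v \<in> I\<close> by auto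
    then have "\<Union>(set ?bs) \<in> L" using lab(3) Union_sd_in_complex[OF assms(1)] l by simp
    ultimately obtain \<delta> where \<delta>: "\<delta> \<in> sd L" "label \<delta> = ?bs" using sd_of_blocks[OF complex] by blast
    have "label \<gamma> = xs @ ({v} \<union> (I - {v})) # ys" using l vI by simp
    then have eq: "\<delta> = ?\<delta>" using split_block(1)[OF complex assms(1) \<delta>(1)] \<delta>(2) by blast
    show ?thesis
    proof (cases "\<Union>\<gamma> \<in> critical L F")
      case True
      then have "is_pivot (Ord (\<Union>\<gamma>)) \<gamma> v" using assms(2) pivotal_critical by simp
      moreover from this have ne: "\<gamma> \<noteq> flag (Ord (\<Union>\<gamma>))" by (rule is_pivot_not_flag)
      ultimately have "v = pivot L Ord (\<Union>\<gamma>) \<gamma>"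
        using pivot_iff_is_pivot[OF True assms(1)] by simp
      moreover have "\<gamma> \<noteq> crit_flag L Ord (\<Union>\<gamma>)" using ne crit_flag_eq_flag(1)[OF True] by simp
      ultimately show ?thesis
        using sd_field.split_critical[OF True assms(1) \<delta>(1) carrier_simplex_sd[OF assms(1)] _ _
            l \<open>v \<in> I\<close> I \<delta>(2), of Ord] eq by blast
    next
      case False
      then obtain \<alpha> \<beta> where "(\<alpha>, \<beta>) \<in> F" "\<beta> - \<alpha> = {v}" "\<Union>\<gamma> \<in> {\<alpha>, \<beta>}"
        using assms(2) unfolding pivotal_def by blast
      moreover from this have "\<Union>\<gamma> = \<beta>" using True by auto
      ultimately show ?thesis
        using sd_field.split_apex[OF _ _ assms(1) \<delta>(1) _ l \<open>v \<in> I\<close> I \<delta>(2)]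
          carrier_simplex_sd[OF assms(1)] eq by blast
    qed
  next
    case False
    then have b: "below v \<gamma> = \<Union>\<gamma>" by (rule below_eq_Union)
    have "\<not> (\<Union>\<gamma> \<in> critical L F \<and> is_pivot (Ord (\<Union>\<gamma>)) \<gamma> v)"
      using False ord(2)[of "\<Union>\<gamma>"] is_pivot_mem[of "Ord (\<Union>\<gamma>)" \<gamma> v] by metis
    then obtain \<alpha> \<beta> where *: "(\<alpha>, \<beta>) \<in> F" "\<beta> - \<alpha> = {v}" "\<Union>\<gamma> \<in> {\<alpha>, \<beta>}"
      using assms(2) unfolding pivotal_def by blast
    have "\<Union>\<gamma> \<noteq> \<beta>" using False *(2) by blast
    then have "\<Union>\<gamma> = \<alpha>" using *(3) by simp
    let ?bs = "label \<gamma> @ [{v}]"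
    have "disjoint_blocks {} ?bs" using lab(2,3) False by (simp add: disjoint_blocks_append)
    moreover have "\<Union>(set ?bs) \<in> L"
      using lab(3) pivotal_insert_in_complex[OF assms(1,2)] b by simp
    ultimately obtain \<delta> where \<delta>: "\<delta> \<in> sd L" "label \<delta> = ?bs" using sd_of_blocks[OF complex] by blast
    then have "\<delta> = ?\<delta>" using append_block(1)[OF complex assms(1) \<delta>] b by simp
    then show ?thesis
      using sd_field.append_apex[OF *(1,2) assms(1) \<delta>(1) _ \<delta>(2)] carrier_simplex_sd[OF assms(1)]
        \<open>\<Union>\<gamma> = \<alpha>\<close> by blast
  qed
qed

lemma sd_fieldE:
  assumes "(\<gamma>, \<delta>) \<in> V"
  obtains v where "\<gamma> \<in> sd L" "\<delta> \<in> sd L" "pivotal \<gamma> v" "pivotal \<delta> v"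
    "insert v (below v \<gamma>) \<notin> \<gamma>" "\<delta> = insert (insert v (below v \<gamma>)) \<gamma>" "below v \<delta> = below v \<gamma>"
proof -
  obtain v where v: "\<gamma> \<in> sd L" "\<delta> \<in> sd L" "pivotal \<gamma> v"
    "insert v (below v \<gamma>) \<notin> \<gamma>" "\<delta> = insert (insert v (below v \<gamma>)) \<gamma>"
    using sd_field_sound[OF assms] by blast
  have "pivotal \<delta> v" using pivotal_insert_below[OF v(1,4)] v(2,3,5) by simp
  moreover have "below v \<delta> = below v \<gamma>" using v(5) by simp
  ultimately show thesis by (rule that[OF v(1-3) _ v(4,5)])
qed

text \<open>The chain cannot consist of the set to be removed alone. Its carrier would be the vertex \<open>{v}\<close>, which is neither
the upper member of a pair of \<open>F\<close> nor does it have an initial segment that is missing.\<close>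

lemma sd_field_removal:
  assumes "\<delta> \<in> sd L" "pivotal \<delta> v" "insert v (below v \<delta>) \<in> \<delta>"
  shows "(\<delta> - {insert v (below v \<delta>)}, \<delta>) \<in> V"
proof -
  let ?s = "insert v (below v \<delta>)"
  let ?\<gamma> = "\<delta> - {?s}"
  have b: "below v ?\<gamma> = below v \<delta>" by simp
  have ne: "?\<gamma> \<noteq> {}"
  proof
    assume "?\<gamma> = {}"
    then have \<delta>: "\<delta> = {?s}" using assms(3) by blast
    then have "below v \<delta> = {}" by (auto simp: below_def)
    then have U: "\<Union>\<delta> = {v}" using \<delta> by auto
    show False
    proof (cases "\<Union>\<delta> \<in> critical L F")
      case True
      then have "is_pivot (Ord {v}) \<delta> v" using pivotal_critical assms(2) U by simp
      then obtain xs ys where "Ord {v} = xs @ v # ys" "xs \<noteq> []" unfolding is_pivot_def by blast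
      moreover have "distinct (Ord {v})" "set (Ord {v}) = {v}" using ord[OF True] U by simp_all
      ultimately show False by (cases xs) auto
    next
      case False
      then obtain \<alpha> \<beta> where *: "(\<alpha>, \<beta>) \<in> F" "\<beta> - \<alpha> = {v}" "\<Union>\<delta> \<in> {\<alpha>, \<beta>}"
        using assms(2) unfolding pivotal_def by blast
      then have "\<beta> = {v}" unfolding U by blast
      then have "\<alpha> = {}" using pair_diff[OF *(1,2)] by (metis insert_ident empty_iff)
      then show False using pair_mem[OF *(1)] simplexD(2)[OF complex] by blast
    qed
  qed
  have g: "?\<gamma> \<in> sd L" using sd_Diff_singleton[OF assms(1) ne] .
  have \<delta>: "insert (insert v (below v ?\<gamma>)) ?\<gamma> = \<delta>" unfolding b using assms(3) by blast
  have n: "insert v (below v ?\<gamma>) \<notin> ?\<gamma>" unfolding b by simp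
  have "pivotal ?\<gamma> v" using pivotal_insert_below[OF g n] assms(1,2) unfolding \<delta> by simp
  from sd_field_complete[OF g this n] show ?thesis unfolding \<delta> .
qed

lemma facet_insert_below:
  assumes "(\<gamma>, \<delta>) \<in> V" shows "facet \<gamma> \<delta>"
proof -
  obtain v where "\<gamma> \<in> sd L" "insert v (below v \<gamma>) \<notin> \<gamma>" "\<delta> = insert (insert v (below v \<gamma>)) \<gamma>"
    using assms by (rule sd_fieldE) blast
  then show ?thesis using facet_simplex_iff[OF simplicial_complex_sd] by blast
qed

text \<open>The distinguished vertex \<open>v\<close> and \<open>below v\<close> agree on both members of a pair, so a simplex determines its
partner, and the membership of \<open>insert v (below v \<gamma>)\<close> decides whether it is the upper one.\<close>

theorem sd_field_discrete_vector_field: "discrete_vector_field (sd L) V"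
proof -
  have sub: "V \<subseteq> sd L \<times> sd L" using sd_field_sound by auto
  have fst_eq: "\<delta> = \<delta>'" if "(\<gamma>, \<delta>) \<in> V" "(\<gamma>, \<delta>') \<in> V" for \<gamma> \<delta> \<delta>'
    using sd_field_sound[OF that(1)] sd_field_sound[OF that(2)] pivotal_unique[of \<gamma>] by metis
  have snd_eq: "\<gamma> = \<gamma>'" if 1: "(\<gamma>, \<delta>) \<in> V" and 2: "(\<gamma>', \<delta>) \<in> V" for \<gamma> \<gamma>' \<delta>
  proof -
    obtain v where v: "\<delta> \<in> sd L" "pivotal \<delta> v"
      "insert v (below v \<gamma>) \<notin> \<gamma>" "\<delta> = insert (insert v (below v \<gamma>)) \<gamma>" "below v \<delta> = below v \<gamma>"
      using 1 by (rule sd_fieldE) blast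
    obtain w where w: "pivotal \<delta> w"
      "insert w (below w \<gamma>') \<notin> \<gamma>'" "\<delta> = insert (insert w (below w \<gamma>')) \<gamma>'" "below w \<delta> = below w \<gamma>'"
      using 2 by (rule sd_fieldE) blast
    have "v = w" using pivotal_unique v(1,2) w(1) by blast
    have "\<gamma> = \<delta> - {insert v (below v \<delta>)}"
      using Diff_insert_absorb[OF v(3)] v(4,5) by simp
    moreover have "\<gamma>' = \<delta> - {insert v (below v \<delta>)}"
      using Diff_insert_absorb[OF w(2)] w(3,4) \<open>v = w\<close> by simp
    ultimately show ?thesis by simp
  qed
  have cross: False if 1: "(\<gamma>, \<delta>) \<in> V" and 2: "(\<delta>, \<epsilon>) \<in> V" for \<gamma> \<delta> \<epsilon>
  proof -
    obtain v where v: "\<delta> \<in> sd L" "pivotal \<delta> v"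
      "\<delta> = insert (insert v (below v \<gamma>)) \<gamma>" "below v \<delta> = below v \<gamma>"
      using 1 by (rule sd_fieldE) blast
    obtain w where w: "pivotal \<delta> w" "insert w (below w \<delta>) \<notin> \<delta>" using 2 by (rule sd_fieldE) blast
    have "v = w" using pivotal_unique v(1,2) w(1) by blast
    moreover have "insert v (below v \<gamma>) \<in> \<delta>" using v(3) by blast
    ultimately show False using v(4) w(2) by simp
  qed
  have "p = q" if "p \<in> V" "q \<in> V" "{fst p, snd p} \<inter> {fst q, snd q} \<noteq> {}" for p q
  proof -
    obtain a b c d where pq: "p = (a, b)" "q = (c, d)" by (cases p; cases q) blast
    have V: "(a, b) \<in> V" "(c, d) \<in> V" using that(1,2) pq by simp_all
    have "{a, b} \<inter> {c, d} \<noteq> {}" using that(3) pq by simp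
    then consider "a = c" | "b = d" | "a = d" | "b = c" by blast
    then show ?thesis
    proof cases
      case 1
      with V have "b = d" by (metis fst_eq)
      with 1 pq show ?thesis by simp
    next
      case 2
      with V have "a = c" by (metis snd_eq)
      with 2 pq show ?thesis by simp
    next
      case 3
      with V cross[of c d b] show ?thesis by simp
    next
      case 4
      with V cross[of a b d] show ?thesis by simp
    qed
  qed
  then show ?thesis unfolding discrete_vector_field_def using sub facet_insert_below by auto
qed

text \<open>A chain with a distinguished vertex is the lower or the upper member of a pair. Without one, it can
only be the flag of a critical simplex, which has no pivot.\<close>

theorem critical_sd_field: "critical (sd L) V = {flag (Ord \<alpha>) |\<alpha>. \<alpha> \<in> critical L F}"
proof -
  have "\<gamma> \<notin> critical (sd L) V" if "\<gamma> \<in> sd L" "pivotal \<gamma> v" for \<gamma> v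
  proof (cases "insert v (below v \<gamma>) \<in> \<gamma>")
    case True
    then show ?thesis using sd_field_removal[OF that] unfolding critical_def by blast
  next
    case False
    then show ?thesis using sd_field_complete[OF that] unfolding critical_def by blast
  qed
  then have "\<gamma> \<in> {flag (Ord \<alpha>) |\<alpha>. \<alpha> \<in> critical L F}" if "\<gamma> \<in> critical (sd L) V" for \<gamma>
    using that pivotal_exists[of \<gamma>] unfolding critical_def by blast
  moreover have "flag (Ord \<alpha>) \<in> critical (sd L) V" if \<alpha>: "\<alpha> \<in> critical L F" for \<alpha>
  proof -
    note c = crit_flag_eq_flag[OF \<alpha>]
    have "\<not> pivotal (flag (Ord \<alpha>)) v" for v
      using pivotal_critical[of "flag (Ord \<alpha>)" v] is_pivot_not_flag[of "Ord \<alpha>" "flag (Ord \<alpha>)" v] \<alpha> c(4)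
      by auto
    moreover have "flag (Ord \<alpha>) \<noteq> \<gamma> \<and> flag (Ord \<alpha>) \<noteq> \<delta>" if pair: "(\<gamma>, \<delta>) \<in> V" for \<gamma> \<delta>
    proof -
      obtain v where "pivotal \<gamma> v" "pivotal \<delta> v" using pair by (rule sd_fieldE) blast
      with \<open>\<And>v. \<not> pivotal (flag (Ord \<alpha>)) v\<close> show ?thesis by blast
    qed
    ultimately show ?thesis unfolding critical_def using c(2) by blast
  qed
  ultimately show ?thesis by blast
qed

end

section \<open>Paths of discrete vector fields\<close>

lemma is_path_pair:
  "is_path K F p [b, a] \<longleftrightarrow> b \<in> K \<and> a \<in> K \<and> sdim b = p + 1 \<and> sdim a = p \<and> facet a b"
proof
  assume "is_path K F p [b, a]"
  then obtain m where "length [b, a] = 2 * m + 2" and *: "\<forall>i\<le>m. [b, a] ! (2 * i) \<in> K \<and>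
      sdim ([b, a] ! (2 * i)) = p + 1 \<and> [b, a] ! (2 * i + 1) \<in> K \<and>
      sdim ([b, a] ! (2 * i + 1)) = p \<and> facet ([b, a] ! (2 * i + 1)) ([b, a] ! (2 * i))"
    unfolding is_path_def by blast
  then have "m = 0" by simp
  with * show "b \<in> K \<and> a \<in> K \<and> sdim b = p + 1 \<and> sdim a = p \<and> facet a b" by simp
next
  assume "b \<in> K \<and> a \<in> K \<and> sdim b = p + 1 \<and> sdim a = p \<and> facet a b"
  then show "is_path K F p [b, a]" unfolding is_path_def by (intro exI[of _ 0]) simp
qed

text \<open>Paths are decomposed at their end, since gradient paths are reconstructed backwards.\<close>

lemma is_path_snoc:
  assumes "s \<noteq> []"
  shows "is_path K F p (s @ [b, a]) \<longleftrightarrow> is_path K F p s \<and> (last s, b) \<in> F \<and> facet (last s) b \<and>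
    last s \<noteq> a \<and> b \<in> K \<and> a \<in> K \<and> sdim b = p + 1 \<and> sdim a = p \<and> facet a b"
proof
  let ?t = "s @ [b, a]"
  assume "is_path K F p ?t"
  then obtain m where m: "length ?t = 2 * m + 2"
    and A: "\<And>i. i \<le> m \<Longrightarrow> ?t ! (2 * i) \<in> K \<and> sdim (?t ! (2 * i)) = p + 1 \<and>
      ?t ! (2 * i + 1) \<in> K \<and> sdim (?t ! (2 * i + 1)) = p \<and> facet (?t ! (2 * i + 1)) (?t ! (2 * i))"
    and B: "\<And>i. i < m \<Longrightarrow> (?t ! (2 * i + 1), ?t ! (2 * i + 2)) \<in> F \<and>
      facet (?t ! (2 * i + 1)) (?t ! (2 * i + 2)) \<and> ?t ! (2 * i + 1) \<noteq> ?t ! (2 * i + 3)"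
    unfolding is_path_def by blast
  have ls: "length s = 2 * m" using m by simp
  then obtain k where k: "m = Suc k" using assms by (cases m) auto
  then have lk: "length s = 2 * k + 2" using ls by simp
  have eq: "?t ! i = s ! i" if "i < 2 * k + 2" for i using that lk by (simp add: nth_append)
  have last: "last s = s ! (2 * k + 1)" using assms lk by (simp add: last_conv_nth)
  have b: "?t ! (2 * k + 2) = b" "?t ! (2 * k + 3) = a" using lk by (simp_all add: nth_append)
  have "is_path K F p s"
    unfolding is_path_def
  proof (intro exI[of _ k] conjI allI impI)
    show "length s = 2 * k + 2" by (rule lk)
  next
    fix i assume "i \<le> k"
    then show "s ! (2 * i) \<in> K" "sdim (s ! (2 * i)) = p + 1" "s ! (2 * i + 1) \<in> K"
      "sdim (s ! (2 * i + 1)) = p" "facet (s ! (2 * i + 1)) (s ! (2 * i))"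
      using A[of i] eq[of "2 * i"] eq[of "2 * i + 1"] k by simp_all
  next
    fix i assume "i < k"
    then show "(s ! (2 * i + 1), s ! (2 * i + 2)) \<in> F" "facet (s ! (2 * i + 1)) (s ! (2 * i + 2))"
      "s ! (2 * i + 1) \<noteq> s ! (2 * i + 3)"
      using B[of i] eq[of "2 * i + 1"] eq[of "2 * i + 2"] eq[of "2 * i + 3"] k by simp_all
  qed
  moreover have "(last s, b) \<in> F" "facet (last s) b" "last s \<noteq> a"
    using B[of k] eq[of "2 * k + 1"] last b k by simp_all
  moreover have "b \<in> K" "a \<in> K" "sdim b = p + 1" "sdim a = p" "facet a b"
    using A[of "Suc k"] b k by (simp_all add: numeral_3_eq_3)
  ultimately show "is_path K F p s \<and> (last s, b) \<in> F \<and> facet (last s) b \<and>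
    last s \<noteq> a \<and> b \<in> K \<and> a \<in> K \<and> sdim b = p + 1 \<and> sdim a = p \<and> facet a b" by blast
next
  let ?t = "s @ [b, a]"
  assume *: "is_path K F p s \<and> (last s, b) \<in> F \<and> facet (last s) b \<and>
    last s \<noteq> a \<and> b \<in> K \<and> a \<in> K \<and> sdim b = p + 1 \<and> sdim a = p \<and> facet a b"
  then obtain k where lk: "length s = 2 * k + 2"
    and A: "\<And>i. i \<le> k \<Longrightarrow> s ! (2 * i) \<in> K \<and> sdim (s ! (2 * i)) = p + 1 \<and>
      s ! (2 * i + 1) \<in> K \<and> sdim (s ! (2 * i + 1)) = p \<and> facet (s ! (2 * i + 1)) (s ! (2 * i))"
    and B: "\<And>i. i < k \<Longrightarrow> (s ! (2 * i + 1), s ! (2 * i + 2)) \<in> F \<and>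
      facet (s ! (2 * i + 1)) (s ! (2 * i + 2)) \<and> s ! (2 * i + 1) \<noteq> s ! (2 * i + 3)"
    unfolding is_path_def by blast
  have eq: "?t ! i = s ! i" if "i < 2 * k + 2" for i using that lk by (simp add: nth_append)
  have last: "last s = s ! (2 * k + 1)" using assms lk by (simp add: last_conv_nth)
  have b: "?t ! (2 * k + 2) = b" "?t ! (2 * k + 3) = a" using lk by (simp_all add: nth_append)
  show "is_path K F p ?t"
    unfolding is_path_def
  proof (intro exI[of _ "Suc k"] conjI allI impI)
    show "length ?t = 2 * Suc k + 2" using lk by simp
  next
    fix i assume "i \<le> Suc k"
    then show "?t ! (2 * i) \<in> K" "sdim (?t ! (2 * i)) = p + 1" "?t ! (2 * i + 1) \<in> K"
      "sdim (?t ! (2 * i + 1)) = p" "facet (?t ! (2 * i + 1)) (?t ! (2 * i))"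
      using A[of i] eq[of "2 * i"] eq[of "2 * i + 1"] b *
      by (cases "i = Suc k"; simp add: numeral_3_eq_3)+
  next
    fix i assume "i < Suc k"
    then show "(?t ! (2 * i + 1), ?t ! (2 * i + 2)) \<in> F" "facet (?t ! (2 * i + 1)) (?t ! (2 * i + 2))"
      "?t ! (2 * i + 1) \<noteq> ?t ! (2 * i + 3)"
      using B[of i] eq[of "2 * i + 1"] eq[of "2 * i + 2"] eq[of "2 * i + 3"] b last *
      by (cases "i = k"; simp)+
  qed
qed

lemma is_path_induct [consumes 1, case_names pair snoc]:
  assumes "is_path K F p s"
    and "\<And>b a. is_path K F p [b, a] \<Longrightarrow> P [b, a]"
    and "\<And>s b a. s \<noteq> [] \<Longrightarrow> is_path K F p s \<Longrightarrow> is_path K F p (s @ [b, a]) \<Longrightarrow> P s \<Longrightarrow> P (s @ [b, a])"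
  shows "P s"
  using assms(1)
proof (induction "length s" arbitrary: s rule: less_induct)
  case less
  obtain m where m: "length s = 2 * m + 2" using less.prems unfolding is_path_def by blast
  then obtain t b a where s: "s = t @ [b, a]" "length t = 2 * m"
    by (cases s rule: rev_cases; cases "butlast s" rule: rev_cases) auto
  show ?case
  proof (cases "t = []")
    case True
    then show ?thesis using assms(2) less.prems s by simp
  next
    case False
    then have "is_path K F p t" using less.prems is_path_snoc s(1) by blast
    moreover from this have "P t" using less.hyps s(1) by simp
    ultimately show ?thesis using assms(3)[OF False] less.prems s(1) by blast
  qed
qed

text \<open>The steps from \<open>\<alpha>\<^sub>i\<close> to \<open>\<alpha>\<^sub>i\<^sub>+\<^sub>1\<close> along a path.\<close>

definition flow :: "('a set \<times> 'a set) set \<Rightarrow> 'a set rel" where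
  "flow F = {(a, a'). \<exists>b. (a, b) \<in> F \<and> facet a' b \<and> a' \<noteq> a}"

lemma dvfD:
  assumes "discrete_vector_field K F" "(a, b) \<in> F"
  shows "a \<in> K" "b \<in> K" "facet a b"
  using assms unfolding discrete_vector_field_def by blast+

lemma facet_sdim: "facet a b \<Longrightarrow> sdim b = sdim a + 1"
  by (simp add: facet_def)

text \<open>A cycle of the flow through \<open>x\<close> is a closed path, once an initial simplex is put in front; the
partner of \<open>x\<close> is suitable.\<close>

lemma acyclic_flow:
  assumes "discrete_morse K F"
  shows "acyclic (flow F)"
proof (rule acyclicI, intro allI notI)
  have dvf: "discrete_vector_field K F" using assms unfolding discrete_morse_def by blast
  fix x assume "(x, x) \<in> (flow F)\<^sup>+"
  have path: "\<exists>s b. is_path K F (sdim x) (b # x # s) \<and> s \<noteq> [] \<and> last s = y \<and> sdim y = sdim x"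
    if "(x, y) \<in> (flow F)\<^sup>+" "y \<in> K" for y
    using that
  proof (induction rule: trancl_induct)
    case (base y)
    then obtain b where b: "(x, b) \<in> F" "facet y b" "y \<noteq> x" unfolding flow_def by blast
    have "is_path K F (sdim x) [b, x]"
      unfolding is_path_pair using dvfD[OF dvf b(1)] facet_sdim[of x b] by simp
    then have "is_path K F (sdim x) ([b, x] @ [b, y])"
      unfolding is_path_snoc[OF list.distinct(2)] 
      using dvfD[OF dvf b(1)] facet_sdim[of x b] facet_sdim[of y b] b base.prems by simp
    then show ?case using facet_sdim[of x b] facet_sdim[of y b] dvfD(3)[OF dvf b(1)] b(2)
      by (intro exI[of _ "[b, y]"] exI[of _ b]) simp
  next
    case (step y z)
    then obtain b where b: "(y, b) \<in> F" "facet z b" "z \<noteq> y" unfolding flow_def by blast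
    then obtain s c where s: "is_path K F (sdim x) (c # x # s)" "s \<noteq> []" "last s = y" "sdim y = sdim x"
      using step.IH dvfD[OF dvf b(1)] by blast
    have "is_path K F (sdim x) ((c # x # s) @ [b, z])"
      unfolding is_path_snoc[OF list.distinct(2)] 
      using dvfD[OF dvf b(1)] facet_sdim[of y b] facet_sdim[of z b] b step.prems s by simp
    then show ?case using facet_sdim[of y b] facet_sdim[of z b] dvfD(3)[OF dvf b(1)] b(2) s(4)
      by (intro exI[of _ "s @ [b, z]"] exI[of _ c]) simp
  qed
  have "x \<in> K"
    using \<open>(x, x) \<in> (flow F)\<^sup>+\<close> by (cases rule: converse_tranclE) (auto simp: flow_def dest: dvfD(1)[OF dvf])
  then obtain s b where s: "is_path K F (sdim x) (b # x # s)" "s \<noteq> []" "last s = x"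
    using path \<open>(x, x) \<in> (flow F)\<^sup>+\<close> by blast
  moreover have "even (length (b # x # s))" using s(1) unfolding is_path_def by auto
  then have "length (b # x # s) \<ge> 4" using s(2) by (cases s rule: list.exhaust; cases "tl s") auto
  ultimately have "is_closed_path K F (sdim x) (b # x # s)" unfolding is_closed_path_def by simp
  then show False using assms unfolding discrete_morse_def by blast
qed

text \<open>On a closed path every \<open>\<alpha>\<^sub>i\<close> is followed by its partner, hence it suffices to exclude cycles within the domain
of the field.\<close>

lemma no_closed_path:
  assumes "acyclic {(a, a'). (a, a') \<in> flow F \<and> a' \<in> Domain F}"
  shows "\<not> is_closed_path K F p s"
proof
  let ?r = "{(a, a'). (a, a') \<in> flow F \<and> a' \<in> Domain F}"
  assume c: "is_closed_path K F p s"
  have "is_path K F p s" "length s \<ge> 4" "last s = s ! 1" using c unfolding is_closed_path_def by blast+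
  moreover have "length s \<ge> 4 \<longrightarrow> (s ! 1 \<in> Domain F) \<and> (last s \<in> Domain F \<longrightarrow> (s ! 1, last s) \<in> ?r\<^sup>+)"
    using \<open>is_path K F p s\<close>
  proof (induction rule: is_path_induct)
    case (pair b a)
    then show ?case by simp
  next
    case (snoc s b a)
    then have *: "(last s, b) \<in> F" "last s \<noteq> a" "facet a b" using is_path_snoc[OF snoc(1)] by blast+
    have "length s = 2 \<or> length s \<ge> 4" "length s \<ge> 2" using snoc(2) unfolding is_path_def by auto
    have d: "last s \<in> Domain F" using *(1) by blast
    have e: "a \<in> Domain F \<Longrightarrow> (last s, a) \<in> ?r" using * unfolding flow_def by blast
    have n: "(s @ [b, a]) ! 1 = s ! 1" using \<open>length s \<ge> 2\<close> by (simp add: nth_append)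
    show ?case
    proof (cases "length s = 2")
      case True
      then have "s ! 1 = last s" by (metis One_nat_def diff_Suc_1 last_conv_nth numeral_2_eq_2 snoc.hyps(1))
      then show ?thesis using d e n by auto
    next
      case False
      then have "s ! 1 \<in> Domain F \<and> (s ! 1, last s) \<in> ?r\<^sup>+"
        using snoc.IH d \<open>length s = 2 \<or> length s \<ge> 4\<close> by blast
      then show ?thesis using e n trancl_into_trancl[of "s ! 1" "last s" ?r a] by simp
    qed
  qed
  ultimately have "(s ! 1, s ! 1) \<in> ?r\<^sup>+" by simp
  with assms show False unfolding acyclic_def by blast
qed

text \<open>Gradient paths without their last simplex. As the members of a pair determine each other, the
condition \<open>\<alpha>\<^sub>i \<noteq> \<alpha>\<^sub>i\<^sub>+\<^sub>1\<close> says that \<open>\<alpha>\<^sub>i\<^sub>+\<^sub>1\<close> is not the partner of the \<open>\<beta>\<^sub>i\<close> it follows. The equivalent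
form \<open>\<beta>\<^sub>i \<noteq> \<beta>\<^sub>i\<^sub>+\<^sub>1\<close> also covers \<open>\<beta>\<^sub>0\<close>, which has no partner.\<close>

inductive_set stems :: "'a set set \<Rightarrow> ('a set \<times> 'a set) set \<Rightarrow> 'a set list set" for K F where
  start: "b \<in> critical K F \<Longrightarrow> [b] \<in> stems K F"
| extend: "w \<in> stems K F \<Longrightarrow> (a, b) \<in> F \<Longrightarrow> facet a (last w) \<Longrightarrow> last w \<noteq> b \<Longrightarrow> w @ [a, b] \<in> stems K F"

lemma stem_nonempty: "w \<in> stems K F \<Longrightarrow> w \<noteq> []"
  by (cases rule: stems.cases) auto

lemma dvf_unique:
  assumes "discrete_vector_field K F" "(a, b) \<in> F" "(a', b') \<in> F" "a = a' \<or> a = b' \<or> b = a' \<or> b = b'"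
  shows "a = a'" "b = b'"
proof -
  have "{fst (a, b), snd (a, b)} \<inter> {fst (a', b'), snd (a', b')} \<noteq> {}" using assms(4) by auto
  then have "(a, b) = (a', b')" using assms(1-3) unfolding discrete_vector_field_def by blast
  then show "a = a'" "b = b'" by simp_all
qed

lemma path_of_stem:
  assumes "discrete_vector_field K F" "w \<in> stems K F" "a \<in> K" "facet a (last w)" "(a, last w) \<notin> F"
  shows "is_path K F (sdim a) (w @ [a]) \<and> hd w \<in> critical K F"
  using assms(2-)
proof (induction arbitrary: a)
  case (start b)
  then have "b \<in> K" unfolding critical_def by blast
  then show ?case using start facet_sdim[of a b] is_path_pair[of K F "sdim a" b a] by simp
next
  case (extend w c b)
  note d = dvfD[OF assms(1) extend.hyps(2)]
  have "(c, last w) \<notin> F" using dvf_unique(2)[OF assms(1) extend.hyps(2)] extend.hyps(4) by blast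
  then have IH: "is_path K F (sdim c) (w @ [c]) \<and> hd w \<in> critical K F"
    using extend.IH[OF d(1) extend.hyps(3)] by blast
  have "sdim c = sdim a" using extend.prems(2) d(3) facet_sdim[of a b] facet_sdim[of c b] by simp
  moreover have "c \<noteq> a" using extend.prems(3) extend.hyps(2) by auto
  ultimately have "is_path K F (sdim a) ((w @ [c]) @ [b, a])"
    using is_path_snoc[of "w @ [c]" K F "sdim a" b a] IH d extend.hyps(2) extend.prems facet_sdim[of c b] by simp
  then show ?case using IH stem_nonempty[OF extend.hyps(1)] by simp
qed

lemma stem_of_path:
  assumes "discrete_vector_field K F" "is_path K F p s" "hd s \<in> critical K F"
  shows "\<exists>w a. s = w @ [a] \<and> w \<in> stems K F \<and> a \<in> K \<and> facet a (last w) \<and> (a, last w) \<notin> F"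
  using assms(2,3)
proof (induction rule: is_path_induct)
  case (pair b a)
  then have b: "b \<in> critical K F" "a \<in> K" "facet a b" using is_path_pair[of K F p b a] by simp_all
  moreover from b(1) have "(a, b) \<notin> F" unfolding critical_def by blast
  ultimately show ?case using stems.start[of b K F] by (intro exI[of _ "[b]"] exI[of _ a]) simp
next
  case (snoc s b a)
  then obtain w c where w: "s = w @ [c]" "w \<in> stems K F" "c \<in> K" "facet c (last w)" "(c, last w) \<notin> F"
    by auto
  have *: "(c, b) \<in> F" "c \<noteq> a" "facet a b" "a \<in> K"
    using snoc(3) is_path_snoc[OF snoc(1)] w(1) by auto
  have "w @ [c, b] \<in> stems K F" using stems.extend[OF w(2) *(1) w(4)] w(5) *(1) by auto
  moreover have "(a, b) \<notin> F" using dvf_unique(1)[OF assms(1) *(1)] *(2) by blast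
  ultimately show ?case using * w(1) by (intro exI[of _ "w @ [c, b]"] exI[of _ a]) simp
qed

lemma gradient_paths_eq_stems:
  assumes "discrete_vector_field K F"
  shows "gradient_paths K F = {w @ [a] |w a. w \<in> stems K F \<and> facet a (last w) \<and> a \<in> critical K F}"
proof (intro set_eqI iffI)
  fix s assume "s \<in> gradient_paths K F"
  then obtain p where s: "is_path K F p s" "hd s \<in> critical K F" "last s \<in> critical K F"
    unfolding gradient_paths_def by blast
  then obtain w a where "s = w @ [a]" "w \<in> stems K F" "facet a (last w)"
    using stem_of_path[OF assms s(1,2)] by blast
  with s(3) show "s \<in> {w @ [a] |w a. w \<in> stems K F \<and> facet a (last w) \<and> a \<in> critical K F}" by auto
next
  fix s assume "s \<in> {w @ [a] |w a. w \<in> stems K F \<and> facet a (last w) \<and> a \<in> critical K F}"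
  then obtain w a where w: "s = w @ [a]" "w \<in> stems K F" "facet a (last w)" "a \<in> critical K F" by blast
  have "a \<in> K" "(a, last w) \<notin> F" using w(4) unfolding critical_def by blast+
  from path_of_stem[OF assms w(2) this(1) w(3) this(2)]
  show "s \<in> gradient_paths K F"
    unfolding gradient_paths_def using w(1,4) stem_nonempty[OF w(2)] by auto
qed

section \<open>The subdivided field has no closed paths\<close>

lemma Union_insert_below:
  "v \<in> \<Union>\<gamma> \<Longrightarrow> \<Union>(insert (insert v (below v \<gamma>)) \<gamma>) = \<Union>\<gamma>"
  using below_subset_Union[of v \<gamma>] by (simp add: Un_absorb1 insert_absorb del: Union_iff)

text \<open>A lexicographic argument in which one component is not a number but moves along an acyclic relation.
That relation need not be well-founded, as the complex may be infinite.\<close>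

lemma acyclic_by_potential:
  fixes h m n :: "'a \<Rightarrow> nat"
  assumes "acyclic Q"
    and step: "\<And>x y. (x, y) \<in> r \<Longrightarrow> h y < h x \<or> h y \<le> h x \<and>
      ((k x, k y) \<in> Q \<or> k x = k y \<and> (m y < m x \<or> m y = m x \<and> n y < n x))"
  shows "acyclic r"
proof (rule acyclicI, intro allI notI)
  fix x assume "(x, x) \<in> r\<^sup>+"
  have "h y < h x \<or> h y \<le> h x \<and>
      ((k x, k y) \<in> Q\<^sup>+ \<or> k x = k y \<and> (m y < m x \<or> m y = m x \<and> n y < n x))"
    if "(x, y) \<in> r\<^sup>+" for y
    using that
  proof (induction rule: trancl_induct)
    case (base y)
    then show ?case using assms(2)[OF base] by (auto intro: r_into_trancl)
  next
    case (step y z)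
    consider "h z < h y" | "h z \<le> h y" "(k y, k z) \<in> Q"
      | "h z \<le> h y" "k y = k z" "m z < m y \<or> m z = m y \<and> n z < n y"
      using assms(2)[OF step.hyps(2)] by blast
    then show ?case
    proof cases
      case 1
      then show ?thesis using step.IH by auto
    next
      case 2
      then show ?thesis using step.IH by (auto intro: trancl_into_trancl)
    next
      case 3
      then show ?thesis using step.IH by auto
    qed
  qed
  from this[OF \<open>(x, x) \<in> r\<^sup>+\<close>] show False using assms(1) unfolding acyclic_def by auto
qed

text \<open>In a smaller chain the segment missing in \<open>\<delta>\<close> is still missing, so the longest missing segment
is this one or a longer one. The length of the part of \<open>vs\<close> from the pivot on measures this.\<close>

lemma is_pivot_subset:
  assumes "distinct vs" "is_pivot vs \<delta> v" "is_pivot vs \<gamma> w" "\<gamma> \<subseteq> \<delta>"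
  shows "w = v \<or> length (dropWhile (\<lambda>x. x \<noteq> w) vs) < length (dropWhile (\<lambda>x. x \<noteq> v) vs)"
proof -
  obtain xs ys where x: "vs = xs @ v # ys" "set xs \<notin> \<delta>"
    using assms(2) unfolding is_pivot_def by blast
  obtain xs' ys' where x': "vs = xs' @ w # ys'" "\<forall>p q. ys' = p @ q \<longrightarrow> set (xs' @ w # p) \<in> \<gamma>"
    using assms(3) unfolding is_pivot_def by blast
  have dw: "dropWhile (\<lambda>x. x \<noteq> u) (as @ u # bs) = u # bs" if "u \<notin> set as" for u as and bs :: "'a list"
    using that by (induction as) auto
  have "v \<notin> set xs" using assms(1) unfolding x(1) by simp
  moreover have "w \<notin> set xs'" using assms(1) unfolding x'(1) by simp
  ultimately have d: "dropWhile (\<lambda>x. x \<noteq> v) vs = v # ys" "dropWhile (\<lambda>x. x \<noteq> w) vs = w # ys'"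
    using dw x(1) x'(1) by metis+
  have eq: "xs' @ w # ys' = xs @ v # ys" using x(1) x'(1) by simp
  have "\<not> length xs' < length xs"
  proof
    assume lt: "length xs' < length xs"
    obtain us where us: "xs = xs' @ us" "us @ v # ys = w # ys'"
      using eq lt by (auto simp: append_eq_append_conv2)
    then obtain p where p: "us = w # p" using lt by (cases us) auto
    then have "ys' = p @ v # ys" using us(2) by simp
    then have "set (xs' @ w # p) \<in> \<gamma>" using x'(2) by blast
    then show False using us(1) p x(2) assms(4) by auto
  qed
  moreover have "length xs' + length ys' = length xs + length ys" using arg_cong[OF eq, of length] by simp
  moreover have "w = v" if "length xs' = length xs" using eq that by simp
  ultimately show ?thesis unfolding d by (cases "length xs' = length xs") auto
qed

context vector_field_with_orderings
begin

definition apex :: "'v set set \<Rightarrow> 'v" where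
  "apex \<gamma> = (THE v. pivotal \<gamma> v)"

lemma apex_eq: "\<gamma> \<in> sd L \<Longrightarrow> pivotal \<gamma> v \<Longrightarrow> apex \<gamma> = v"
  unfolding apex_def using pivotal_unique[of \<gamma>] by blast

text \<open>Identifies both members of a pair of \<open>F\<close>, so that it does not change when the carrier rises.\<close>

definition base :: "'v set \<Rightarrow> 'v set" where
  "base \<sigma> = (if \<sigma> \<in> Range F then THE \<alpha>. (\<alpha>, \<sigma>) \<in> F else \<sigma>)"

lemma base_upper:
  assumes "(\<alpha>, \<sigma>) \<in> F"
  shows "base \<sigma> = \<alpha>"
proof -
  have "(THE \<alpha>. (\<alpha>, \<sigma>) \<in> F) = \<alpha>"
  proof (rule the_equality[of "\<lambda>\<alpha>. (\<alpha>, \<sigma>) \<in> F", OF assms])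
    fix \<alpha>' assume "(\<alpha>', \<sigma>) \<in> F"
    from pair_unique[OF this assms, of \<sigma>] show "\<alpha>' = \<alpha>" by simp
  qed
  moreover have "\<sigma> \<in> Range F" using assms by blast
  ultimately show ?thesis unfolding base_def by simp
qed

text \<open>Adding one to the cardinality, except on upper members of pairs of \<open>F\<close>, makes the two members of
a pair equally high.\<close>

definition height :: "'v set \<Rightarrow> nat" where
  "height \<sigma> = (if \<sigma> \<in> Range F then card \<sigma> else Suc (card \<sigma>))"

text \<open>One more than the length of the common suffix with \<open>\<alpha>'\<close> in a critical simplex \<open>\<alpha>\<close>. Inside a pair of
\<open>F\<close> the distinguished vertex is fixed, and nothing has to be counted.\<close>

definition agreement :: "'v set set \<Rightarrow> nat" where
  "agreement \<gamma> = (if \<Union>\<gamma> \<in> critical L F then length (dropWhile (\<lambda>x. x \<noteq> apex \<gamma>) (Ord (\<Union>\<gamma>))) else 0)"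

lemma lower_not_Range: "(\<alpha>, \<beta>) \<in> F \<Longrightarrow> \<alpha> \<notin> Range F"
proof
  assume 1: "(\<alpha>, \<beta>) \<in> F" and "\<alpha> \<in> Range F"
  then obtain \<rho> where 2: "(\<rho>, \<alpha>) \<in> F" by blast
  have "\<alpha> = \<beta>" using pair_unique[OF 1 2, of \<alpha>] by simp
  then show False using facet_sdim dvfD(3)[OF field 1] by fastforce
qed

text \<open>The distinguished vertex is missing from the carrier only if the carrier is the lower member of a pair of \<open>F\<close>.\<close>

lemma pivot_in_carrier:
  assumes "\<Union>\<gamma> \<in> critical L F \<or> \<Union>\<gamma> \<in> Range F" "pivotal \<gamma> v"
  shows "v \<in> \<Union>\<gamma>"
proof (cases "\<Union>\<gamma> \<in> critical L F")
  case True
  then have "is_pivot (Ord (\<Union>\<gamma>)) \<gamma> v" using pivotal_critical[OF True] assms(2) by simp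
  then show ?thesis using is_pivot_mem ord(2)[OF True] by fastforce
next
  case False
  then obtain \<alpha> where u: "(\<alpha>, \<Union>\<gamma>) \<in> F" using assms(1) by blast
  then have "\<Union>\<gamma> - \<alpha> = {v}" using pivotal_pair[OF u, of \<gamma>] assms(2) by simp
  then show ?thesis by blast
qed

text \<open>The step removes from \<open>\<delta>\<close> a set other than the one inserted before, so \<open>insert v (below v \<gamma>)\<close> is still a member.
If \<open>v\<close> is distinguished for \<open>\<gamma>'\<close> as well, \<open>below v\<close> must have changed, as \<open>\<gamma>'\<close> is again a lower
member; so it became smaller. If it is not, although the carrier is the same, then the carrier is critical and the agreement with \<open>Ord\<close>
got shorter. The carrier rises when it is a lower member of a pair of \<open>F\<close>, and
then \<open>height\<close>, \<open>base\<close> and \<open>v\<close> do not change. When the carrier falls, \<open>height\<close> drops, except from the upper member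
of a pair to one of its facets that is no upper member. This facet still contains \<open>v\<close>, hence differs from the lower
member, and \<open>base\<close> makes a step in the flow of \<open>F\<close>.\<close>

lemma flow_step:
  assumes "(\<gamma>, \<gamma>') \<in> flow V" "\<gamma>' \<in> Domain V"
  shows "height (\<Union>\<gamma>') < height (\<Union>\<gamma>) \<or> height (\<Union>\<gamma>') \<le> height (\<Union>\<gamma>) \<and>
    ((base (\<Union>\<gamma>), base (\<Union>\<gamma>')) \<in> flow F \<or> base (\<Union>\<gamma>) = base (\<Union>\<gamma>') \<and>
     (agreement \<gamma>' < agreement \<gamma> \<or> agreement \<gamma>' = agreement \<gamma> \<and>
      card (below (apex \<gamma>') \<gamma>') < card (below (apex \<gamma>) \<gamma>)))"
proof -
  obtain \<delta> where \<delta>: "(\<gamma>, \<delta>) \<in> V" "facet \<gamma>' \<delta>" "\<gamma>' \<noteq> \<gamma>" using assms(1) unfolding flow_def by blast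
  obtain v where v: "\<gamma> \<in> sd L" "\<delta> \<in> sd L" "pivotal \<gamma> v" "pivotal \<delta> v"
    "insert v (below v \<gamma>) \<notin> \<gamma>" "\<delta> = insert (insert v (below v \<gamma>)) \<gamma>" "below v \<delta> = below v \<gamma>"
    using \<delta>(1) by (rule sd_fieldE) blast
  obtain \<delta>' where "(\<gamma>', \<delta>') \<in> V" using assms(2) by blast
  then obtain w where w: "\<gamma>' \<in> sd L" "pivotal \<gamma>' w" "insert w (below w \<gamma>') \<notin> \<gamma>'"
    by (rule sd_fieldE) blast
  obtain s where s: "s \<notin> \<gamma>'" "\<delta> = insert s \<gamma>'"
    using \<delta>(2) facet_simplex_iff[OF simplicial_complex_sd w(1)] by blast
  \<comment> \<open>Removing the inserted set again would lead back to \<open>\<gamma>\<close>.\<close>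
  have j: "insert v (below v \<gamma>) \<in> \<gamma>'"
  proof (rule ccontr)
    assume "insert v (below v \<gamma>) \<notin> \<gamma>'"
    moreover have "insert v (below v \<gamma>) \<in> insert s \<gamma>'" using v(6) s(2) by simp
    ultimately have "insert v (below v \<gamma>) = s" by simp
    then have "\<gamma>' = \<gamma>" using insert_ident[OF s(1), of \<gamma>] s(2) v(5,6) by simp
    with \<delta>(3) show False by simp
  qed
  have sub: "\<Union>\<gamma>' \<subseteq> \<Union>\<delta>" using s(2) by blast
  have fin: "finite (\<Union>\<gamma>)" "finite (\<Union>\<gamma>')"
    using simplexD(1)[OF complex Union_sd_in_complex] v(1) w(1) by simp_all
  have apex: "apex \<gamma> = v" "apex \<gamma>' = w" using apex_eq v(1,3) w(1,2) by simp_all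
  have less: "card (below (apex \<gamma>') \<gamma>') < card (below (apex \<gamma>) \<gamma>)" if "w = v"
  proof -
    have "below v \<gamma>' \<subseteq> below v \<delta>" using s(2) by (intro below_mono) blast
    moreover have "below v \<gamma>' \<noteq> below v \<gamma>" using w(3) j \<open>w = v\<close> by auto
    moreover have "finite (below v \<gamma>)" using fin(1) below_subset_Union finite_subset by metis
    ultimately show ?thesis unfolding apex \<open>w = v\<close> using v(7) by (intro psubset_card_mono) auto
  qed
  have eq: "w = v" if "pivotal \<gamma>' v" using pivotal_unique[OF w(1,2) that] .
  have height_le: "height \<sigma> \<le> Suc (card \<sigma>)" for \<sigma> by (simp add: height_def)
  have U: "\<Union>\<delta> = \<Union>\<gamma>" if "v \<in> \<Union>\<gamma>"
    using Union_insert_below[OF that] v(6) by simp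
  have drop: "card (\<Union>\<gamma>') < card (\<Union>\<gamma>)" if "v \<in> \<Union>\<gamma>" "\<Union>\<gamma>' \<noteq> \<Union>\<gamma>"
    using sub U[OF that(1)] that(2) fin(1) by (intro psubset_card_mono) auto
  show ?thesis
    using Union_sd_in_complex[OF v(1)]
  proof (cases rule: simplex_cases)
    case (lower \<beta>)
    have d: "\<beta> - \<Union>\<gamma> = {v}" using pivotal_pair[OF lower, of \<gamma>] v(3) by simp
    note \<beta> = pair_diff[OF lower d]
    have j\<beta>: "insert v (below v \<gamma>) = \<beta>" using below_eq_Union[OF \<beta>(2)] \<beta>(1) by simp
    then have "\<Union>\<delta> = \<beta>" using v(6) \<beta>(1) by (simp add: Un_absorb1 subset_insertI)
    then have U': "\<Union>\<gamma>' = \<beta>" using sub Union_upper[OF j] j\<beta> by simp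
    have "w = v" using eq pivotal_pair[OF lower, of \<gamma>' v] d U' by simp
    moreover have "agreement \<gamma> = 0" "agreement \<gamma>' = 0"
      using pair_not_critical[OF lower] U' unfolding agreement_def by simp_all
    moreover have "height (\<Union>\<gamma>) = Suc (card (\<Union>\<gamma>))"
      using lower_not_Range[OF lower] unfolding height_def by simp
    moreover have "height (\<Union>\<gamma>') = Suc (card (\<Union>\<gamma>))"
      using lower \<beta> fin(1) unfolding height_def U' by auto
    moreover have "base (\<Union>\<gamma>) = \<Union>\<gamma>" using lower_not_Range[OF lower] unfolding base_def by simp
    moreover have "base (\<Union>\<gamma>') = \<Union>\<gamma>" using base_upper[OF lower] U' by simp
    ultimately show ?thesis using less by simp
  next
    case (upper \<alpha>)
    have d: "\<Union>\<gamma> - \<alpha> = {v}" using pivotal_pair[OF upper, of \<gamma>] v(3) by simp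
    then have vU: "v \<in> \<Union>\<gamma>" by blast
    have hg: "height (\<Union>\<gamma>) = card (\<Union>\<gamma>)" using upper unfolding height_def by auto
    show ?thesis
    proof (cases "\<Union>\<gamma>' = \<Union>\<gamma>")
      case True
      have "w = v" using eq pivotal_pair[OF upper, of \<gamma>' v] d True by simp
      moreover have "agreement \<gamma> = 0" "agreement \<gamma>' = 0"
        using pair_not_critical[OF upper] True unfolding agreement_def by simp_all
      ultimately show ?thesis using less True by simp
    next
      case False
      note c = drop[OF vU False]
      show ?thesis
      proof (cases "height (\<Union>\<gamma>') < height (\<Union>\<gamma>)")
        case no: False
        then have nR: "\<Union>\<gamma>' \<notin> Range F" and ceq: "card (\<Union>\<gamma>) = Suc (card (\<Union>\<gamma>'))"
          using hg c height_le[of "\<Union>\<gamma>'"] unfolding height_def by (auto split: if_splits)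
        have "\<Union>\<gamma>' \<noteq> {}" using simplexD(2)[OF complex Union_sd_in_complex[OF w(1)]] .
        then have "card (\<Union>\<gamma>') > 0" using fin(2) by (simp add: card_gt_0_iff)
        then have "facet (\<Union>\<gamma>') (\<Union>\<gamma>)"
          using sub U[OF vU] False ceq unfolding facet_def sdim_def by auto
        moreover have "\<Union>\<gamma>' \<noteq> \<alpha>" using j pair_diff(2)[OF upper d] by blast
        ultimately have "(\<alpha>, \<Union>\<gamma>') \<in> flow F" using upper unfolding flow_def by blast
        moreover have "base (\<Union>\<gamma>) = \<alpha>" using base_upper[OF upper] .
        moreover have "base (\<Union>\<gamma>') = \<Union>\<gamma>'" using nR unfolding base_def by simp
        moreover have "height (\<Union>\<gamma>') \<le> height (\<Union>\<gamma>)" using hg ceq height_le[of "\<Union>\<gamma>'"] by simp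
        ultimately show ?thesis by simp
      qed blast
    qed
  next
    case crit
    have vU: "v \<in> \<Union>\<gamma>" using pivot_in_carrier crit v(3) by blast
    have "\<Union>\<gamma> \<notin> Range F" using crit pair_not_critical by blast
    then have hg: "height (\<Union>\<gamma>) = Suc (card (\<Union>\<gamma>))" unfolding height_def by simp
    show ?thesis
    proof (cases "\<Union>\<gamma>' = \<Union>\<gamma>")
      case True
      have "is_pivot (Ord (\<Union>\<gamma>)) \<delta> v" using pivotal_critical[of \<delta>] v(4) U[OF vU] crit by simp
      moreover have "is_pivot (Ord (\<Union>\<gamma>)) \<gamma>' w" using pivotal_critical[of \<gamma>'] w(2) True crit by simp
      ultimately have "w = v \<or> length (dropWhile (\<lambda>x. x \<noteq> w) (Ord (\<Union>\<gamma>))) <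
          length (dropWhile (\<lambda>x. x \<noteq> v) (Ord (\<Union>\<gamma>)))"
        using is_pivot_subset[OF ord(1)[OF crit]] s(2) by blast
      then show ?thesis using less True crit apex unfolding agreement_def by auto
    next
      case False
      then show ?thesis using drop[OF vU False] hg height_le[of "\<Union>\<gamma>'"] by simp
    qed
  qed
qed

lemma acyclic_flow_sd_field:
  assumes "acyclic (flow F)"
  shows "acyclic {(\<gamma>, \<gamma>'). (\<gamma>, \<gamma>') \<in> flow V \<and> \<gamma>' \<in> Domain V}"
  using assms
  by (rule acyclic_by_potential[where h = "\<lambda>\<gamma>. height (\<Union>\<gamma>)" and k = "\<lambda>\<gamma>. base (\<Union>\<gamma>)" and
        m = agreement and n = "\<lambda>\<gamma>. card (below (apex \<gamma>) \<gamma>)"]) (use flow_step in blast)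

theorem discrete_morse_sd_field:
  assumes "discrete_morse L F"
  shows "discrete_morse (sd L) V"
  unfolding discrete_morse_def
  using sd_field_discrete_vector_field no_closed_path[OF acyclic_flow_sd_field[OF acyclic_flow[OF assms]]]
  by blast

end

section \<open>Lifting gradient paths\<close>

lemma full_flag:
  assumes "distinct vs"
  shows "full (flag vs)" and "\<Union>(flag vs) = set vs"
proof -
  have dist: "distinct xs" if "sorted_wrt (\<subset>) xs" for xs :: "'a set list"
    using that by (induction xs) auto
  have len: "length (partial_unions A bs) = length bs" for A :: "'a set" and bs
    by (induction bs arbitrary: A) auto
  show U: "\<Union>(flag vs) = set vs"
    unfolding flag_eq_partial_unions using Union_partial_unions[of "singletons vs"] by simp
  have "disjoint_blocks {} (singletons vs)" using assms by (simp add: disjoint_blocks_singletons)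
  then have "distinct (partial_unions {} (singletons vs))" using dist sorted_partial_unions(1) by blast
  then have "card (flag vs) = length (singletons vs)"
    unfolding flag_eq_partial_unions by (simp add: distinct_card len)
  also have "\<dots> = card (set vs)" using assms by (simp add: singletons_def distinct_card)
  finally show "full (flag vs)" unfolding full_def U .
qed

text \<open>Each block of the label is a singleton: for \<open>v\<close> in a block, a full chain contains the union of the earlier
blocks with \<open>v\<close> added, so nothing else fits into the block.\<close>

lemma full_is_flag:
  assumes "simplicial_complex L" "\<gamma> \<in> sd L" "full \<gamma>"
  obtains vs where "distinct vs" "set vs = \<Union>\<gamma>" "flag vs = \<gamma>"
proof -
  note lab = label_sd[OF assms(1,2)]
  have "\<exists>v. b = {v}" if mem: "b \<in> set (label \<gamma>)" for b
  proof -
    obtain xs ys where l: "label \<gamma> = xs @ b # ys" using mem by (meson split_list)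
    let ?X = "\<Union>(set xs)"
    have d: "disjoint_blocks {} (xs @ b # ys)" using lab(2) l by simp
    then have b: "b \<noteq> {}" "b \<inter> ?X = {}" by (auto simp: disjoint_blocks_append)
    then obtain v where v: "v \<in> b" by blast
    then have nv: "v \<notin> ?X" using b(2) by blast
    have below: "below v \<gamma> = ?X" using below_of_blocks[OF d v] lab(1) l by simp
    have "v \<in> \<Union>\<gamma>" using lab(3) v l by auto
    then have "insert v ?X \<in> \<gamma>" using full_mem[OF assms, of v] below by simp
    then have "insert v ?X \<in> set (partial_unions {} xs) \<or> insert v ?X \<in> set (partial_unions ?X (b # ys))"
      using lab(1) unfolding l by (auto simp: partial_unions_append)
    moreover have "insert v ?X \<notin> set (partial_unions {} xs)"
      using partial_unions_between(2)[of "insert v ?X" "{}" xs] nv by blast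
    ultimately have "insert v ?X = ?X \<union> b \<or> insert v ?X \<in> set (partial_unions (?X \<union> b) ys)" by simp
    then have "b \<subseteq> insert v ?X"
      using partial_unions_between(1)[of "insert v ?X" "?X \<union> b" ys] by blast
    then have "b = {v}" using b(2) v by blast
    then show ?thesis by blast
  qed
  then have "singletons (map the_elem (label \<gamma>)) = label \<gamma>"
    unfolding singletons_def map_map by (intro map_idI) fastforce
  then obtain vs where vs: "label \<gamma> = singletons vs" by metis
  have "distinct vs" using lab(2) unfolding vs by (simp add: disjoint_blocks_singletons)
  moreover have "set vs = \<Union>\<gamma>" using lab(3) unfolding vs by simp
  moreover have "flag vs = \<gamma>" using lab(1) unfolding vs flag_eq_partial_unions .
  ultimately show thesis by (rule that)
qed

text \<open>A codimension one face \<open>\<gamma>\<close> of full chains with the same carrier has one block \<open>{v, w}\<close>. The two full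
chains above it insert \<open>v\<close> or \<open>w\<close> first. The first of them adds \<open>insert v (below v \<gamma>)\<close>, and the other
one adds everything below the least member with \<open>v\<close>, except for \<open>v\<close>.\<close>

lemma full_coface_unique:
  assumes "simplicial_complex L" "\<gamma> \<in> sd L" "v \<in> \<Union>\<gamma>" "insert v (below v \<gamma>) \<notin> \<gamma>"
    and "s \<notin> \<gamma>" "insert s \<gamma> \<in> sd L" "full (insert s \<gamma>)" "\<Union>(insert s \<gamma>) = \<Union>\<gamma>" "s \<noteq> insert v (below v \<gamma>)"
  shows "s = \<Inter>{c\<in>\<gamma>. v \<in> c} - {v}"
proof -
  let ?x = "insert s \<gamma>" and ?A = "below v \<gamma>"
  have mem: "insert v (below v ?x) \<in> ?x"
    using full_mem[OF assms(1,6,7), of v] assms(3) unfolding assms(8) by blast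
  have ne: "below v ?x \<noteq> ?A" using mem assms(4,9) by auto
  have vs: "v \<notin> s" using ne by auto
  then have bx: "below v ?x = s \<union> ?A" unfolding below_def by auto
  have "?A = {} \<or> ?A \<in> ?x" using below_cases[OF assms(2), of v] by blast
  then have "s \<subseteq> ?A \<or> ?A \<subseteq> s" using sdD(4)[OF assms(6), of s ?A] by auto
  then have bs: "below v ?x = s" using ne bx by auto
  then have "insert v s \<in> \<gamma>" using mem vs by auto
  then have "\<Inter>{c\<in>\<gamma>. v \<in> c} \<subseteq> insert v s" by auto
  moreover have "insert v s \<subseteq> c" if "c \<in> \<gamma>" "v \<in> c" for c
    using below_lower[OF assms(6), of c v] that bs by auto
  then have "insert v s \<subseteq> \<Inter>{c\<in>\<gamma>. v \<in> c}" by blast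
  ultimately have "\<Inter>{c\<in>\<gamma>. v \<in> c} = insert v s" by (rule subset_antisym)
  then show ?thesis using vs by simp
qed

text \<open>Exchanges \<open>v\<close> with the vertex after it in the order that belongs to the full chain.\<close>

lemma full_coface_exists:
  assumes "simplicial_complex L" "\<beta> \<in> sd L" "full \<beta>" "v \<in> \<Union>\<beta>"
    and "insert v (below v \<beta>) \<in> \<beta>" "insert v (below v \<beta>) \<noteq> \<Union>\<beta>"
  obtains \<xi> where "\<xi> \<in> sd L" "full \<xi>" "\<Union>\<xi> = \<Union>\<beta>" "\<xi> \<noteq> \<beta>" "facet (\<beta> - {insert v (below v \<beta>)}) \<xi>"
    and "\<Union>(\<beta> - {insert v (below v \<beta>)}) = \<Union>\<beta>"
proof -
  let ?A = "below v \<beta>" and ?j = "insert v (below v \<beta>)"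
  let ?\<alpha> = "\<beta> - {?j}"
  have top: "\<Union>\<beta> \<in> ?\<alpha>" using Union_in_sd[OF assms(2)] assms(6) by auto
  then have U: "\<Union>?\<alpha> = \<Union>\<beta>" by auto
  have \<alpha>: "?\<alpha> \<in> sd L" using sd_Diff_singleton[OF assms(2), of ?j] top by auto
  \<comment> \<open>In the order of the full chain, \<open>C\<close> is reached by adding to \<open>?j\<close> the vertex after \<open>v\<close>.\<close>
  let ?S = "{c\<in>?\<alpha>. v \<in> c}"
  have "finite ?S" "?S \<noteq> {}" using sdD(2)[OF assms(2)] top assms(4) by auto
  then obtain C where C: "C \<in> ?S" "\<forall>c\<in>?S. c \<subseteq> C \<longrightarrow> C = c"
    using finite_has_minimal[of ?S] by blast
  have least: "C \<subseteq> c" if "c \<in> ?S" for c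
    using that C sdD(4)[OF \<alpha>, of C c] by blast
  have jC: "?j \<subset> C" using below_lower[OF assms(2), of C v] C(1) by auto
  let ?s = "C - {v}"
  have sne: "?s \<noteq> {}" "?A \<subset> ?s"
  proof -
    obtain x where "x \<in> C" "x \<notin> ?j" using jC by blast
    then show "?s \<noteq> {}" "?A \<subset> ?s" using jC by auto
  qed
  have sn: "?s \<notin> \<beta>" using below_upper[of ?s \<beta> v] sne(2) by auto
  let ?\<xi> = "insert ?s ?\<alpha>"
  have comp: "?s \<subseteq> c \<or> c \<subseteq> ?s" if "c \<in> ?\<alpha>" for c
  proof (cases "v \<in> c")
    case True
    then show ?thesis using least[of c] that by blast
  next
    case False
    then have "c \<subseteq> ?A" using below_upper[of c \<beta> v] that by blast
    then show ?thesis using sne(2) by blast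
  qed
  have "C \<in> L" using C(1) sdD(3)[OF assms(2)] by blast
  then have "?s \<in> L" using simplexD(3)[OF assms(1), of C ?s] sne(1) by blast
  have \<xi>: "?\<xi> \<in> sd L"
  proof (rule sdI)
    show "?\<xi> \<subseteq> L" using \<open>?s \<in> L\<close> sdD(3)[OF \<alpha>] by simp
    show "s \<subseteq> t \<or> t \<subseteq> s" if "s \<in> ?\<xi>" "t \<in> ?\<xi>" for s t
      using that comp sdD(4)[OF \<alpha>, of s t] by (elim insertE) auto
  qed (use sdD(2)[OF \<alpha>] in simp_all)
  have U\<xi>: "\<Union>?\<xi> = \<Union>\<beta>"
  proof -
    have "?s \<subseteq> \<Union>?\<alpha>" using C(1) by blast
    then show ?thesis using U by (simp add: Un_absorb1)
  qed
  have sn': "?s \<notin> ?\<alpha>" using sn by simp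
  have fin: "finite \<beta>" using sdD(2)[OF assms(2)] .
  have "card ?\<xi> = Suc (card ?\<alpha>)" using sn' fin by simp
  also have "\<dots> = card \<beta>" using card_Suc_Diff1[OF fin assms(5)] .
  finally have "full ?\<xi>" using assms(3) U\<xi> unfolding full_def by simp
  moreover have "?\<xi> \<noteq> \<beta>" using sn by blast
  moreover have "facet ?\<alpha> ?\<xi>" using facet_simplex_iff[OF simplicial_complex_sd \<alpha>] sn' by blast
  ultimately show thesis by (rule that[OF \<xi> _ U\<xi> _ _ U])
qed

lemma project_path_snoc:
  assumes "w \<noteq> []"
  shows "project_path (w @ [x]) = (if carrier_simplex x = last (project_path w) then project_path w
    else project_path w @ [carrier_simplex x])"
  using assms remdups_adj_append_two[of "map carrier_simplex (butlast w)" "carrier_simplex (last w)" "carrier_simplex x"]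
  by (cases w rule: rev_cases) (auto simp: project_path_def)

lemma last_project_path: "w \<noteq> [] \<Longrightarrow> last (project_path w) = carrier_simplex (last w)"
  by (simp add: project_path_def last_map)

lemma project_path_extend:
  assumes "w \<noteq> []"
  shows "project_path (w @ [a, b]) = project_path w @
    (if carrier_simplex a = carrier_simplex (last w) then [] else [carrier_simplex a]) @
    (if carrier_simplex b = carrier_simplex a then [] else [carrier_simplex b])"
  using project_path_snoc[OF assms, of a] project_path_snoc[of "w @ [a]" b] last_project_path[OF assms]
    last_project_path[of "w @ [a]"] by auto

lemma hd_project_path: "w \<noteq> [] \<Longrightarrow> hd (project_path w) = carrier_simplex (hd w)"
  by (cases w) (simp_all add: project_path_def remdups_adj_Cons')

lemma last_stem: "w \<in> stems K F \<Longrightarrow> last w \<in> critical K F \<or> last w \<in> Range F"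
  by (cases rule: stems.cases) auto

context vector_field_with_orderings
begin

lemma carrier_eq: "\<gamma> \<in> sd L \<Longrightarrow> carrier_simplex \<gamma> = \<Union>\<gamma>"
  by (rule carrier_simplex_sd)

text \<open>The distinguished vertex must be new, which is possible only if the old carrier is the lower member of a
pair of \<open>F\<close>.\<close>

lemma carrier_rise:
  assumes "(a, b) \<in> V" "\<Union>a \<noteq> \<Union>b"
  shows "(\<Union>a, \<Union>b) \<in> F" and "b = insert (\<Union>b) a" and "\<Union>b \<notin> a"
proof -
  obtain v where v: "a \<in> sd L" "pivotal a v" "insert v (below v a) \<notin> a" "b = insert (insert v (below v a)) a"
    using assms(1) by (rule sd_fieldE) blast
  have nv: "v \<notin> \<Union>a" using Union_insert_below[of v a] v(4) assms(2) by metis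
  have "\<not> (\<Union>a \<in> critical L F \<or> \<Union>a \<in> Range F)" using pivot_in_carrier[of a v] v(2) nv by blast
  then obtain \<beta> where \<beta>: "(\<Union>a, \<beta>) \<in> F"
    using Union_sd_in_complex[OF v(1)] unfolding critical_def by blast
  have "\<beta> - \<Union>a = {v}" using pivotal_pair[OF \<beta>, of a] v(2) by simp
  then have j: "insert v (below v a) = \<beta>" using below_eq_Union[OF nv] pair_diff(1)[OF \<beta>] by simp
  moreover have "\<Union>a \<subseteq> \<beta>" using pair_diff(1)[OF \<beta>] \<open>\<beta> - \<Union>a = {v}\<close> by blast
  ultimately have "\<Union>b = \<beta>" using v(4) by (simp add: Un_absorb2)
  then show "(\<Union>a, \<Union>b) \<in> F" "b = insert (\<Union>b) a" "\<Union>b \<notin> a" using \<beta> j v(3,4) by simp_all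
qed

text \<open>A step from a full chain \<open>c\<close> stays inside the carrier or drops its top member. In the first case \<open>a\<close>
has one member less than its carrier has vertices. In the second case \<open>a\<close> is full again, so that no set within its
carrier can be inserted, and the carrier has to rise.\<close>

lemma full_step_cases:
  assumes "c \<in> sd L" "full c" "\<Union>c \<in> critical L F \<or> \<Union>c \<in> Range F" "(a, b) \<in> V" "facet a c" "c \<noteq> b"
  obtains (inner) "\<Union>a = \<Union>c" "\<Union>b = \<Union>c" "full b" "\<not> full a"
  | (drop) "c = insert (\<Union>c) a" "full a" "facet (\<Union>a) (\<Union>c)" "(\<Union>a, \<Union>b) \<in> F" "full b" "\<Union>c \<noteq> \<Union>b" "b = insert (\<Union>b) a"
proof -
  obtain v where v: "a \<in> sd L" "b \<in> sd L" "pivotal a v" "insert v (below v a) \<notin> a"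
      "b = insert (insert v (below v a)) a"
    using assms(4) by (rule sd_fieldE) blast
  obtain s where s: "s \<notin> a" "c = insert s a"
    using assms(5) facet_simplex_iff[OF simplicial_complex_sd v(1)] by blast
  have fin: "finite a" "finite (\<Union>c)" using sdD(2)[OF v(1)] simplexD(1)[OF complex Union_sd_in_complex[OF assms(1)]] by simp_all
  have cb: "card b = Suc (card a)" "card c = Suc (card a)" using v(4,5) s fin(1) by simp_all
  show thesis
  proof (cases "\<Union>a = \<Union>c")
    case True
    then have "v \<in> \<Union>a" using pivot_in_carrier[of a v] v(3) assms(3) by simp
    then have Ub: "\<Union>b = \<Union>c" using Union_insert_below[of v a] v(5) True by simp
    then have "full b" "\<not> full a" using assms(2) cb True unfolding full_def by simp_all
    then show thesis using inner True Ub by blast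
  next
    case False
    have "\<Union>c \<in> insert s a" using Union_in_sd[OF assms(1)] s(2) by simp
    moreover have "\<Union>c \<notin> a"
    proof
      assume "\<Union>c \<in> a"
      then have "\<Union>c \<subseteq> \<Union>a" by (rule Union_upper)
      moreover have "\<Union>a \<subseteq> \<Union>c" using s(2) by (intro Union_mono) blast
      ultimately show False using False by simp
    qed
    ultimately have s_eq: "s = \<Union>c" by simp
    have "\<Union>a \<subset> \<Union>c" using False s(2) by (simp add: psubset_eq Union_mono subset_insertI)
    then have lt: "card (\<Union>a) < card (\<Union>c)" using fin(2) by (intro psubset_card_mono)
    have "card a \<le> card (\<Union>a)" using card_sd_le[OF complex v(1)] .
    then have fa: "full a" "card (\<Union>c) = Suc (card (\<Union>a))"
      using lt cb(2) assms(2) unfolding full_def by simp_all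
    have "\<Union>a \<noteq> {}" using simplexD(2)[OF complex Union_sd_in_complex[OF v(1)]] .
    moreover have "finite (\<Union>a)" using simplexD(1)[OF complex Union_sd_in_complex[OF v(1)]] .
    ultimately have "card (\<Union>a) > 0" by (simp add: card_gt_0_iff)
    then have fc: "facet (\<Union>a) (\<Union>c)" using \<open>\<Union>a \<subset> \<Union>c\<close> fa(2) unfolding facet_def sdim_def by simp
    have nv: "v \<notin> \<Union>a" using full_mem[OF complex v(1) fa(1), of v] v(4) by blast
    have "v \<in> \<Union>b" using v(5) by simp
    then have Ub: "\<Union>a \<noteq> \<Union>b" using nv by blast
    note r = carrier_rise[OF assms(4) Ub]
    have "card (\<Union>b) = Suc (card (\<Union>a))"
      using pair_insert[OF r(1)] \<open>finite (\<Union>a)\<close> by (metis card_insert_disjoint)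
    then have "full b" using cb(1) fa(1) unfolding full_def by simp
    moreover have "\<Union>c \<noteq> \<Union>b" using r(2) s(2) s_eq assms(6) by auto
    ultimately show thesis using drop s(2) s_eq fa(1) fc r(1,2) by blast
  qed
qed

text \<open>A step inside a carrier leaves the projection unchanged, and a fall of the carrier with the rise that must follow
it extends the projection by one step of \<open>F\<close>.\<close>

lemma project_stem:
  assumes "w \<in> stems (sd L) V"
  shows "last w \<in> sd L \<and> full (last w) \<and> project_path w \<in> stems L F \<and> last (project_path w) = \<Union>(last w)"
  using assms
proof induction
  case (start b)
  then obtain \<alpha> where \<alpha>: "\<alpha> \<in> critical L F" "b = flag (Ord \<alpha>)" unfolding critical_sd_field by blast
  then have b: "b \<in> sd L" "\<Union>b = \<alpha>" using crit_flag_eq_flag[OF \<alpha>(1)] by simp_all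
  then have "project_path [b] = [\<alpha>]" using carrier_eq[OF b(1)] by (simp add: project_path_def)
  then show ?case using b full_flag(1)[OF ord(1)[OF \<alpha>(1)]] \<alpha> stems.start[OF \<alpha>(1)] by simp
next
  case (extend w a b)
  note ne = stem_nonempty[OF extend.hyps(1)]
  have ab: "a \<in> sd L" "b \<in> sd L" using dvfD[OF sd_field_discrete_vector_field extend.hyps(2)] by simp_all
  have IH: "last w \<in> sd L" "full (last w)" "project_path w \<in> stems L F" "last (project_path w) = \<Union>(last w)"
    using extend.IH by simp_all
  have c: "carrier_simplex a = \<Union>a" "carrier_simplex b = \<Union>b" "carrier_simplex (last w) = \<Union>(last w)"
    using carrier_eq ab IH(1) by simp_all
  have "\<Union>(last w) \<in> critical L F \<or> \<Union>(last w) \<in> Range F" using last_stem[OF IH(3)] IH(4) by simp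
  from IH(1,2) this extend.hyps(2-4) show ?case
  proof (cases rule: full_step_cases)
    case inner
    then show ?thesis using project_path_extend[OF ne, of a b] c IH ab by simp
  next
    case drop
    have "\<Union>a \<noteq> \<Union>(last w)" using drop(3) unfolding facet_def by blast
    moreover have "\<Union>b \<noteq> \<Union>a" using dvfD(3)[OF field drop(4)] unfolding facet_def by blast
    ultimately have "project_path (w @ [a, b]) = project_path w @ [\<Union>a, \<Union>b]"
      using project_path_extend[OF ne, of a b] c by simp
    moreover have "project_path w @ [\<Union>a, \<Union>b] \<in> stems L F"
      using stems.extend[OF IH(3) drop(4)] drop(3,6) IH(4) by simp
    ultimately show ?thesis using drop(5) ab by simp
  qed
qed

text \<open>Induction from the end. The last simplex determines its partner \<open>a\<close>. Whether \<open>a\<close> is full decides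
in which of the two ways it was reached: by a step inside the carrier, where it has only one full
coface besides its partner, or by dropping the carrier, which can be read off from the projection.\<close>

lemma project_stem_inj:
  assumes "w \<in> stems (sd L) V" "w' \<in> stems (sd L) V" "last w = last w'" "project_path w = project_path w'"
  shows "w = w'"
  using assms
proof (induction arbitrary: w')
  case (start b)
  from start.prems(1) show ?case
  proof cases
    case (start b')
    then show ?thesis using \<open>last [b] = last w'\<close> by simp
  next
    case (extend u a b')
    then have "(a, b) \<in> V" using \<open>last [b] = last w'\<close> by simp
    then show ?thesis using start.hyps unfolding critical_def by blast
  qed
next
  case (extend u a b)
  note u = extend.hyps
  from extend.prems(1) show ?case
  proof cases
    case (start b')
    then have "(a, b') \<in> V" using u(2) extend.prems(2) by simp
    then show ?thesis using start unfolding critical_def by blast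
  next
    case (extend u' a' b')
    have "b' = b" using extend(1) \<open>last (u @ [a, b]) = last w'\<close> by simp
    then have "a' = a" using dvf_unique(1)[OF sd_field_discrete_vector_field extend(3) u(2)] by simp
    note e = extend[unfolded \<open>b' = b\<close> \<open>a' = a\<close>]
    have ab: "a \<in> sd L" "b \<in> sd L" using dvfD[OF sd_field_discrete_vector_field u(2)] by simp_all
    have pu: "last u \<in> sd L" "full (last u)" "project_path u \<in> stems L F" "last (project_path u) = \<Union>(last u)"
      using project_stem[OF u(1)] by simp_all
    have pu': "last u' \<in> sd L" "full (last u')" "project_path u' \<in> stems L F" "last (project_path u') = \<Union>(last u')"
      using project_stem[OF e(2)] by simp_all
    have c: "carrier_simplex a = \<Union>a" "carrier_simplex b = \<Union>b" "carrier_simplex (last u) = \<Union>(last u)"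
      "carrier_simplex (last u') = \<Union>(last u')"
      using carrier_eq ab pu(1) pu'(1) by simp_all
    have pr: "project_path (u @ [a, b]) = project_path (u' @ [a, b])" using extend.prems e(1) \<open>project_path (u @ [a, b]) = project_path w'\<close> by simp
    note pe = project_path_extend[OF stem_nonempty[OF u(1)], of a b]
      project_path_extend[OF stem_nonempty[OF e(2)], of a b]
    have cr: "\<Union>(last u) \<in> critical L F \<or> \<Union>(last u) \<in> Range F" using last_stem[OF pu(3)] pu(4) by simp
    have cr': "\<Union>(last u') \<in> critical L F \<or> \<Union>(last u') \<in> Range F" using last_stem[OF pu'(3)] pu'(4) by simp
    have "last u = last u' \<and> project_path u = project_path u'"
      using pu(1,2) cr u(2-4)
    proof (cases rule: full_step_cases)
      case inner
      note i = this
      show ?thesis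
        using pu'(1,2) cr' u(2) e(4,5)
      proof (cases rule: full_step_cases)
        case inner
        have "project_path u = project_path u'" using pe pr c i(1,2) inner(1,2) by simp
        obtain v where v: "pivotal a v" "insert v (below v a) \<notin> a" "b = insert (insert v (below v a)) a"
          using u(2) by (rule sd_fieldE) blast
        have va: "v \<in> \<Union>a" using pivot_in_carrier[of a v] v(1) cr i(1) by simp
        obtain s where s: "s \<notin> a" "last u = insert s a"
          using u(3) facet_simplex_iff[OF simplicial_complex_sd ab(1)] by blast
        obtain s' where s': "s' \<notin> a" "last u' = insert s' a"
          using e(4) facet_simplex_iff[OF simplicial_complex_sd ab(1)] by blast
        have ne: "s \<noteq> insert v (below v a)" "s' \<noteq> insert v (below v a)"
          using u(4) e(5) v(3) s(2) s'(2) by auto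
        have "s = \<Inter>{c\<in>a. v \<in> c} - {v}"
          by (rule full_coface_unique[OF complex ab(1) va v(2) s(1), folded s(2),
                OF pu(1,2) i(1)[symmetric] ne(1)])
        moreover have "s' = \<Inter>{c\<in>a. v \<in> c} - {v}"
          by (rule full_coface_unique[OF complex ab(1) va v(2) s'(1), folded s'(2),
                OF pu'(1,2) inner(1)[symmetric] ne(2)])
        ultimately have "s = s'" by simp
        then have "last u = last u'" using s(2) s'(2) by simp
        with \<open>project_path u = project_path u'\<close> show ?thesis by simp
      next
        case drop
        then show ?thesis using i(4) by simp
      qed
    next
      case drop
      note d = this
      show ?thesis
        using pu'(1,2) cr' u(2) e(4,5)
      proof (cases rule: full_step_cases)
        case inner
        then show ?thesis using d(2) by simp
      next
        case drop
        have "\<Union>a \<noteq> \<Union>(last u)" "\<Union>a \<noteq> \<Union>(last u')" using d(3) drop(3) unfolding facet_def by blast+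
        then have eq: "project_path u = project_path u'" using pe pr c by simp
        then have "\<Union>(last u) = \<Union>(last u')" using pu(4) pu'(4) by simp
        then show ?thesis using d(1) drop(1) eq by simp
      qed
    qed
    then show ?thesis using extend.IH[OF e(2)] e(1) by simp
  qed
qed

lemma pivotal_noncritical:
  assumes "\<gamma> \<in> sd L" "\<gamma> \<notin> critical (sd L) V"
  shows "\<exists>v. pivotal \<gamma> v"
proof (rule pivotal_exists[OF assms(1)], rule notI)
  assume "\<Union>\<gamma> \<in> critical L F \<and> \<gamma> = flag (Ord (\<Union>\<gamma>))"
  then show False using assms(2) unfolding critical_sd_field by blast
qed

text \<open>Walking backwards inside a single carrier: unless \<open>b\<close> is critical or was entered from below, its
partner has exactly one other full coface \<open>x\<close>, from which a path may have come. The flow is acyclic and the subdivision of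
one simplex is finite, so this ends.\<close>

lemma unwind_induct:
  assumes "acyclic (flow F)" "\<sigma> \<in> critical L F \<or> \<sigma> \<in> Range F"
    and base: "\<And>b. b \<in> sd L \<Longrightarrow> full b \<Longrightarrow> \<Union>b = \<sigma> \<Longrightarrow>
        b \<in> critical (sd L) V \<or> (\<exists>a. (a, b) \<in> V \<and> \<Union>a \<noteq> \<Union>b) \<Longrightarrow> P b"
    and step: "\<And>x a b. P x \<Longrightarrow> \<Union>x = \<sigma> \<Longrightarrow> x \<in> sd L \<Longrightarrow> (a, b) \<in> V \<Longrightarrow> facet a x \<Longrightarrow> x \<noteq> b \<Longrightarrow>
        \<Union>a = \<sigma> \<Longrightarrow> \<Union>b = \<sigma> \<Longrightarrow> P b"
    and b: "b \<in> sd L" "full b" "\<Union>b = \<sigma>"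
  shows "P b"
proof -
  let ?Y = "{a \<in> sd L. \<Union>a = \<sigma>}"
  \<comment> \<open>The induction runs over the lower members \<open>a\<close>, as the flow is a relation between these.\<close>
  let ?r = "{(a, a'). (a, a') \<in> flow V \<and> a' \<in> Domain V} \<inter> ?Y \<times> ?Y"
  have "finite \<sigma>" using simplexD(1)[OF complex Union_sd_in_complex[OF b(1)]] b(3) by simp
  moreover have "?Y \<subseteq> Pow (Pow \<sigma>)" by auto
  ultimately have "finite ?Y" by (meson finite_Pow_iff finite_subset)
  then have "finite ?r" by (intro finite_Int disjI2 finite_cartesian_product)
  moreover have "acyclic ?r" by (rule acyclic_subset[OF acyclic_flow_sd_field[OF assms(1)]]) simp
  ultimately have wf: "wf ?r" by (rule finite_acyclic_wf)
  have *: "P b" if "(a, b) \<in> V" "\<Union>a = \<sigma>" "full b" "\<Union>b = \<sigma>" for a b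
    using wf that
  proof (induction a arbitrary: b rule: wf_induct_rule)
    case (less a)
    obtain v where v: "a \<in> sd L" "b \<in> sd L" "pivotal a v" "pivotal b v" "insert v (below v a) \<notin> a"
      "b = insert (insert v (below v a)) a" "below v b = below v a"
      using less.prems(1) by (rule sd_fieldE) blast
    have vb: "v \<in> \<Union>b" using v(6) by simp
    have a_eq: "b - {insert v (below v b)} = a" using v(5-7) by simp
    have "\<Union>b \<in> a" using Union_in_sd[OF v(1)] less.prems(2,4) by simp
    then have ne: "insert v (below v b) \<noteq> \<Union>b" using v(5,7) by auto
    have jb: "insert v (below v b) \<in> b" using v(6,7) by simp
    obtain x where x: "x \<in> sd L" "full x" "\<Union>x = \<Union>b" "x \<noteq> b" "facet a x"
      by (rule full_coface_exists[OF complex v(2) less.prems(3) vb jb ne, unfolded a_eq]) blast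
    have "P x"
    proof (cases "x \<in> critical (sd L) V \<or> (\<exists>a. (a, x) \<in> V \<and> \<Union>a \<noteq> \<Union>x)")
      case True
      then show ?thesis using base x less.prems(4) by simp
    next
      case False
      then obtain w where w: "pivotal x w" using pivotal_noncritical[OF x(1)] by blast
      have "\<Union>x = \<sigma>" using x(3) less.prems(4) by simp
      then have "w \<in> \<Union>x" using pivot_in_carrier[OF _ w] assms(2) by blast
      then have "insert w (below w x) \<in> x" by (rule full_mem[OF complex x(1,2)])
      then obtain a' where a': "(a', x) \<in> V" using sd_field_removal[OF x(1) w] by blast
      then have Ua': "\<Union>a' = \<sigma>" using False x(3) less.prems(4) by auto
      have "a \<noteq> a'" using dvf_unique(2)[OF sd_field_discrete_vector_field a' less.prems(1)] x(4) by blast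
      then have "(a', a) \<in> flow V" using a' x(5) unfolding flow_def by blast
      moreover have "a' \<in> sd L" using dvfD(1)[OF sd_field_discrete_vector_field a'] .
      ultimately have "(a', a) \<in> ?r" using Ua' less.prems(1,2) v(1) by blast
      then show ?thesis by (rule less.IH[OF _ a' Ua' x(2) \<open>\<Union>x = \<sigma>\<close>])
    qed
    then show ?case using step[OF _ _ x(1) less.prems(1) x(5,4) less.prems(2,4)] x(3) less.prems(4) by simp
  qed
  show ?thesis
  proof (cases "b \<in> critical (sd L) V \<or> (\<exists>a. (a, b) \<in> V \<and> \<Union>a \<noteq> \<Union>b)")
    case True
    then show ?thesis using base b by simp
  next
    case False
    then obtain w where w: "pivotal b w" using pivotal_noncritical[OF b(1)] by blast
    have "w \<in> \<Union>b" using pivot_in_carrier[OF _ w] assms(2) b(3) by blast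
    then have "insert w (below w b) \<in> b" by (rule full_mem[OF complex b(1,2)])
    then obtain a where "(a, b) \<in> V" using sd_field_removal[OF b(1) w] by blast
    then show ?thesis using * False b(2,3) by auto
  qed
qed

lemma insert_coface_in_sd:
  assumes "a \<in> sd L" "full a" "\<beta> \<in> L" "facet (\<Union>a) \<beta>"
  shows "insert \<beta> a \<in> sd L" and "full (insert \<beta> a)" and "\<Union>(insert \<beta> a) = \<beta>" and "\<beta> \<notin> a"
    and "facet a (insert \<beta> a)"
proof -
  have sub: "\<Union>a \<subset> \<beta>" using assms(4) unfolding facet_def by blast
  then show n: "\<beta> \<notin> a" by blast
  show U: "\<Union>(insert \<beta> a) = \<beta>" using sub by auto
  show "insert \<beta> a \<in> sd L"
  proof (rule sdI)
    show "insert \<beta> a \<subseteq> L" using assms(3) sdD(3)[OF assms(1)] by simp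
    have "s \<subseteq> \<beta>" if "s \<in> a" for s using that sub by blast
    then show "s \<subseteq> t \<or> t \<subseteq> s" if "s \<in> insert \<beta> a" "t \<in> insert \<beta> a" for s t
      using that sdD(4)[OF assms(1), of s t] by (elim insertE) auto
  qed (use sdD(2)[OF assms(1)] in simp_all)
  obtain x where "x \<notin> \<Union>a" "\<beta> = insert x (\<Union>a)"
    using assms(4) facet_simplex_iff[OF complex Union_sd_in_complex[OF assms(1)]] by blast
  then have "card \<beta> = Suc (card (\<Union>a))"
    using simplexD(1)[OF complex Union_sd_in_complex[OF assms(1)]] by simp
  then show "full (insert \<beta> a)" using n sdD(2)[OF assms(1)] assms(2) U unfolding full_def by simp
  show "facet a (insert \<beta> a)" using facet_simplex_iff[OF simplicial_complex_sd assms(1)] n by blast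
qed

lemma extend_inner:
  assumes "\<exists>w\<in>stems (sd L) V. last w = x \<and> project_path w = s" "\<Union>x = \<sigma>" "x \<in> sd L"
    and "(a, b) \<in> V" "facet a x" "x \<noteq> b" "\<Union>a = \<sigma>" "\<Union>b = \<sigma>"
  shows "\<exists>w\<in>stems (sd L) V. last w = b \<and> project_path w = s"
proof -
  obtain w where w: "w \<in> stems (sd L) V" "last w = x" "project_path w = s" using assms(1) by blast
  have ab: "a \<in> sd L" "b \<in> sd L" using dvfD[OF sd_field_discrete_vector_field assms(4)] by simp_all
  have "w @ [a, b] \<in> stems (sd L) V" using stems.extend[OF w(1) assms(4)] assms(5,6) w(2) by simp
  moreover have "project_path (w @ [a, b]) = s"
    using project_path_extend[OF stem_nonempty[OF w(1)], of a b] carrier_eq[OF ab(1)]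
      carrier_eq[OF ab(2)] carrier_eq[OF assms(3)] assms(2,7,8) w(2,3) by simp
  ultimately show ?thesis by (intro bexI[of _ "w @ [a, b]"]) simp_all
qed

text \<open>Backwards inside the last carrier, until the critical flag or the simplex at which the carrier was
entered is reached. In the latter case \<open>\<Union>b\<close> was added on top of a full flag of \<open>\<alpha>\<close>, and adding the previous
simplex of the path instead gives the flag from which to continue.\<close>

lemma lift_stem:
  assumes "acyclic (flow F)" "s \<in> stems L F" "b \<in> sd L" "full b" "\<Union>b = last s"
  shows "\<exists>w\<in>stems (sd L) V. last w = b \<and> project_path w = s"
  using assms(2-)
proof (induction arbitrary: b)
  case (start \<beta>)
  show ?case
  proof (rule unwind_induct[OF assms(1), where P = "\<lambda>b. \<exists>w\<in>stems (sd L) V. last w = b \<and> project_path w = [\<beta>]"])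
    show "\<beta> \<in> critical L F \<or> \<beta> \<in> Range F" using start.hyps by simp
    show "b \<in> sd L" "full b" "\<Union>b = \<beta>" using start.prems by simp_all
  next
    fix b assume b: "b \<in> sd L" "full b" "\<Union>b = \<beta>" "b \<in> critical (sd L) V \<or> (\<exists>a. (a, b) \<in> V \<and> \<Union>a \<noteq> \<Union>b)"
    \<comment> \<open>A critical carrier is never entered from below.\<close>
    have "b \<in> critical (sd L) V"
      using b(3,4) carrier_rise(1) pair_not_critical start.hyps by metis
    moreover have "project_path [b] = [\<beta>]" using carrier_eq[OF b(1)] b(3) by (simp add: project_path_def)
    ultimately show "\<exists>w\<in>stems (sd L) V. last w = b \<and> project_path w = [\<beta>]"
      by (intro bexI[of _ "[b]"] stems.start) simp_all
  next
    fix x a b assume x: "\<exists>w\<in>stems (sd L) V. last w = x \<and> project_path w = [\<beta>]" "\<Union>x = \<beta>" "x \<in> sd L"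
      "(a, b) \<in> V" "facet a x" "x \<noteq> b" "\<Union>a = \<beta>" "\<Union>b = \<beta>"
    then show "\<exists>w\<in>stems (sd L) V. last w = b \<and> project_path w = [\<beta>]" using extend_inner by blast
  qed
next
  case (extend s \<alpha> \<beta>)
  let ?P = "\<lambda>b. \<exists>w\<in>stems (sd L) V. last w = b \<and> project_path w = s @ [\<alpha>, \<beta>]"
  show ?case
  proof (rule unwind_induct[OF assms(1), where P = ?P])
    show "\<beta> \<in> critical L F \<or> \<beta> \<in> Range F" using extend.hyps(2) by blast
    show "b \<in> sd L" "full b" "\<Union>b = \<beta>" using extend.prems by simp_all
  next
    fix b assume b: "b \<in> sd L" "full b" "\<Union>b = \<beta>" "b \<in> critical (sd L) V \<or> (\<exists>a. (a, b) \<in> V \<and> \<Union>a \<noteq> \<Union>b)"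
    have "b \<notin> critical (sd L) V"
    proof
      assume "b \<in> critical (sd L) V"
      then obtain \<alpha>' where \<alpha>': "\<alpha>' \<in> critical L F" "b = flag (Ord \<alpha>')" unfolding critical_sd_field by blast
      then have "\<beta> = \<alpha>'" using crit_flag_eq_flag(4)[OF \<alpha>'(1)] b(3) by simp
      then show False using \<alpha>'(1) pair_not_critical[OF extend.hyps(2)] by simp
    qed
    then obtain a where a: "(a, b) \<in> V" "\<Union>a \<noteq> \<Union>b" using b(4) by blast
    note r = carrier_rise[OF a]
    have Ua: "\<Union>a = \<alpha>" using pair_unique[OF r(1) extend.hyps(2), of \<beta>] b(3) by simp
    have a_sd: "a \<in> sd L" using dvfD(1)[OF sd_field_discrete_vector_field a(1)] .
    have fin: "finite a" "finite \<alpha>" using sdD(2)[OF a_sd] simplexD(1)[OF complex] pair_mem[OF extend.hyps(2)] by simp_all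
    have "card b = Suc (card a)" using r(2,3) fin(1) by (metis card_insert_disjoint)
    moreover have "card \<beta> = Suc (card \<alpha>)" using pair_insert[OF extend.hyps(2)] fin(2) by (metis card_insert_disjoint)
    ultimately have fa: "full a" using b(2,3) Ua unfolding full_def by simp
    have lL: "last s \<in> L"
      using last_stem[OF extend.hyps(1)] pair_mem unfolding critical_def by blast
    note x = insert_coface_in_sd[OF a_sd fa lL, unfolded Ua, OF extend.hyps(3)]
    obtain w where w: "w \<in> stems (sd L) V" "last w = insert (last s) a" "project_path w = s"
      using extend.IH[OF x(1,2,3)] by blast
    have xb: "last w \<noteq> b" using x(3) b(3) extend.hyps(4) w(2) by metis
    have "w @ [a, b] \<in> stems (sd L) V" using stems.extend[OF w(1) a(1) _ xb] x(5) w(2) by simp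
    moreover have "project_path (w @ [a, b]) = s @ [\<alpha>, \<beta>]"
    proof -
      have "\<alpha> \<noteq> last s" "\<beta> \<noteq> \<alpha>" using extend.hyps(3) a(2) Ua b(3) unfolding facet_def by auto
      then show ?thesis
        using project_path_extend[OF stem_nonempty[OF w(1)], of a b] carrier_eq[OF a_sd]
          carrier_eq[OF b(1)] carrier_eq[OF x(1)] x(3) w(2,3) b(3) Ua by simp
    qed
    ultimately show "?P b" by (intro bexI[of _ "w @ [a, b]"]) simp_all
  next
    fix x a b assume x: "?P x" "\<Union>x = \<beta>" "x \<in> sd L"
      "(a, b) \<in> V" "facet a x" "x \<noteq> b" "\<Union>a = \<beta>" "\<Union>b = \<beta>"
    then show "?P b" using extend_inner by blast
  qed
qed


section \<open>Critical simplexes and gradient paths of the subdivision\<close>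

lemma critical_sd_fieldD:
  assumes "\<gamma> \<in> critical (sd L) V"
  shows "\<Union>\<gamma> \<in> critical L F" and "\<gamma> = crit_flag L Ord (\<Union>\<gamma>)" and "\<gamma> \<in> sd L" and "full \<gamma>"
proof -
  obtain \<alpha> where \<alpha>: "\<alpha> \<in> critical L F" "\<gamma> = flag (Ord \<alpha>)" using assms unfolding critical_sd_field by blast
  note c = crit_flag_eq_flag[OF \<alpha>(1)]
  then have U: "\<Union>\<gamma> = \<alpha>" using \<alpha>(2) by simp
  show "\<Union>\<gamma> \<in> critical L F" "\<gamma> = crit_flag L Ord (\<Union>\<gamma>)" using U \<alpha> c(1) by simp_all
  show "\<gamma> \<in> sd L" "full \<gamma>" using \<alpha>(2) c(2) full_flag(1)[OF ord(1)[OF \<alpha>(1)]] by simp_all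
qed

lemma crit_flag_critical:
  assumes "\<alpha> \<in> critical L F"
  shows "crit_flag L Ord \<alpha> \<in> critical (sd L) V" and "\<Union>(crit_flag L Ord \<alpha>) = \<alpha>"
  using assms crit_flag_eq_flag[OF assms] unfolding critical_sd_field by auto

lemma critical_sd_field_eq_image: "critical (sd L) V = crit_flag L Ord ` critical L F"
  using critical_sd_fieldD(1,2) crit_flag_critical(1) by (intro set_eqI iffI) (blast, auto)

lemma crit_flag_bij: "bij_betw (crit_flag L Ord) (critical L F) (critical (sd L) V)"
  unfolding critical_sd_field_eq_image
  by (intro inj_on_imp_bij_betw inj_on_inverseI[where g = Union] crit_flag_critical(2))

lemma sdim_full: "full \<gamma> \<Longrightarrow> sdim \<gamma> = sdim (\<Union>\<gamma>)"
  unfolding full_def sdim_def by simp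

lemma full_carrier_eq:
  assumes "\<alpha> \<in> L" "\<gamma> \<in> sd L" "sdim \<gamma> = sdim \<alpha>" "\<Union>\<gamma> \<subseteq> \<alpha>"
  shows "\<Union>\<gamma> = \<alpha>" and "full \<gamma>"
proof -
  have pos: "card \<gamma> > 0" "card \<alpha> > 0"
    using sdD(1,2)[OF assms(2)] simplexD(1,2)[OF complex assms(1)] by (simp_all add: card_gt_0_iff)
  then have "card \<gamma> = card \<alpha>" using assms(3) unfolding sdim_def by linarith
  moreover have "card \<gamma> \<le> card (\<Union>\<gamma>)" using card_sd_le[OF complex assms(2)] .
  ultimately show "\<Union>\<gamma> = \<alpha>" using card_seteq[OF simplexD(1)[OF complex assms(1)] assms(4)] by simp
  then show "full \<gamma>" using \<open>card \<gamma> = card \<alpha>\<close> unfolding full_def by simp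
qed

lemma critical_simplex_in:
  assumes "\<alpha> \<in> critical L F"
  shows "{\<gamma> \<in> critical (sd L) V. sdim \<gamma> = sdim \<alpha> \<and> carrier_simplex \<gamma> \<subseteq> \<alpha>} = {crit_flag L Ord \<alpha>}"
proof (intro set_eqI iffI)
  fix \<gamma> assume "\<gamma> \<in> {crit_flag L Ord \<alpha>}"
  then have \<gamma>: "\<gamma> = crit_flag L Ord \<alpha>" by simp
  note c = crit_flag_critical[OF assms]
  show "\<gamma> \<in> {\<gamma> \<in> critical (sd L) V. sdim \<gamma> = sdim \<alpha> \<and> carrier_simplex \<gamma> \<subseteq> \<alpha>}"
    using c sdim_full[OF critical_sd_fieldD(4)[OF c(1)]] carrier_eq[OF critical_sd_fieldD(3)[OF c(1)]]
    unfolding \<gamma> by simp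
next
  fix \<gamma> assume "\<gamma> \<in> {\<gamma> \<in> critical (sd L) V. sdim \<gamma> = sdim \<alpha> \<and> carrier_simplex \<gamma> \<subseteq> \<alpha>}"
  then have \<gamma>: "\<gamma> \<in> critical (sd L) V" "sdim \<gamma> = sdim \<alpha>" "carrier_simplex \<gamma> \<subseteq> \<alpha>" by simp_all
  note d = critical_sd_fieldD[OF \<gamma>(1)]
  have "\<Union>\<gamma> = \<alpha>"
    using full_carrier_eq[OF ord(4)[OF assms] d(3) \<gamma>(2)] \<gamma>(3) carrier_eq[OF d(3)] by simp
  then show "\<gamma> \<in> {crit_flag L Ord \<alpha>}" using d(2) by simp
qed

text \<open>The final simplex is a full flag, so the last step drops the carrier.\<close>

lemma gradient_path_sdE:
  assumes "t \<in> gradient_paths (sd L) V"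
  obtains w y where "t = w @ [y]" "w \<in> stems (sd L) V" "facet y (last w)" "y \<in> critical (sd L) V"
    "project_path t = project_path w @ [\<Union>y]" "last w = insert (last (project_path w)) y"
    "facet (\<Union>y) (last (project_path w))"
proof -
  obtain w y where t: "t = w @ [y]" "w \<in> stems (sd L) V" "facet y (last w)" "y \<in> critical (sd L) V"
    using assms unfolding gradient_paths_eq_stems[OF sd_field_discrete_vector_field] by blast
  note y = critical_sd_fieldD[OF t(4)]
  have p: "last w \<in> sd L" "full (last w)" "last (project_path w) = \<Union>(last w)"
    using project_stem[OF t(2)] by simp_all
  have fin: "finite (\<Union>y)" "finite (\<Union>(last w))"
    using simplexD(1)[OF complex Union_sd_in_complex] y(3) p(1) by simp_all
  obtain s where s: "s \<notin> y" "last w = insert s y"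
    using t(3) facet_simplex_iff[OF simplicial_complex_sd y(3)] by blast
  have c: "card (\<Union>(last w)) = Suc (card (\<Union>y))"
    using s p(2) y(4) sdD(2)[OF y(3)] unfolding full_def by simp
  have "\<Union>y \<subseteq> \<Union>(last w)" using s(2) by auto
  moreover have ne: "\<Union>y \<noteq> \<Union>(last w)" using c by auto
  moreover have "card (\<Union>y) > 0"
    using simplexD(2)[OF complex Union_sd_in_complex[OF y(3)]] fin(1) by (simp add: card_gt_0_iff)
  ultimately have f: "facet (\<Union>y) (\<Union>(last w))" using c unfolding facet_def sdim_def by auto
  have "\<Union>(last w) \<notin> y" using ne s(2) Union_upper[of "\<Union>(last w)" y] \<open>\<Union>y \<subseteq> \<Union>(last w)\<close> by blast
  moreover have "\<Union>(last w) \<in> insert s y" using Union_in_sd[OF p(1)] s(2) by simp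
  ultimately have "last w = insert (\<Union>(last w)) y" using s(2) by simp
  moreover have "project_path t = project_path w @ [\<Union>y]"
    using project_path_snoc[OF stem_nonempty[OF t(2)], of y] carrier_eq[OF y(3)] p(3) ne t(1) by simp
  ultimately show thesis using that[OF t] f p(3) by simp
qed

text \<open>The final flag is determined by the final simplex of the projection, and the full flag before it
arises by adding the simplex before it. So this is a case of the uniqueness and existence of lifts.\<close>

theorem project_path_bij:
  assumes "discrete_morse L F"
  shows "bij_betw project_path (gradient_paths (sd L) V) (gradient_paths L F)"
  unfolding bij_betw_def
proof (intro conjI subset_antisym)
  show "inj_on project_path (gradient_paths (sd L) V)"
  proof (rule inj_onI)
    fix t t' assume t: "t \<in> gradient_paths (sd L) V" and t': "t' \<in> gradient_paths (sd L) V"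
      and eq: "project_path t = project_path t'"
    obtain w y where w: "t = w @ [y]" "w \<in> stems (sd L) V" "y \<in> critical (sd L) V"
      "project_path t = project_path w @ [\<Union>y]" "last w = insert (last (project_path w)) y"
      using t by (rule gradient_path_sdE) blast
    obtain w' y' where w': "t' = w' @ [y']" "w' \<in> stems (sd L) V" "y' \<in> critical (sd L) V"
      "project_path t' = project_path w' @ [\<Union>y']" "last w' = insert (last (project_path w')) y'"
      using t' by (rule gradient_path_sdE) blast
    have *: "project_path w = project_path w'" "\<Union>y = \<Union>y'" using eq w(4) w'(4) by simp_all
    have "y = y'" using critical_sd_fieldD(2)[OF w(3)] critical_sd_fieldD(2)[OF w'(3)] *(2) by simp
    then show "t = t'" using project_stem_inj[OF w(2) w'(2)] w(1,5) w'(1,5) *(1) by simp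
  qed
  note grL = gradient_paths_eq_stems[OF field]
  show "project_path ` gradient_paths (sd L) V \<subseteq> gradient_paths L F"
  proof (rule image_subsetI)
    fix t assume "t \<in> gradient_paths (sd L) V"
    then obtain w y where w: "w \<in> stems (sd L) V" "y \<in> critical (sd L) V"
      "project_path t = project_path w @ [\<Union>y]" "facet (\<Union>y) (last (project_path w))"
      by (rule gradient_path_sdE) blast
    then show "project_path t \<in> gradient_paths L F"
      unfolding grL using project_stem[OF w(1)] critical_sd_fieldD(1)[OF w(2)] by blast
  qed
  show "gradient_paths L F \<subseteq> project_path ` gradient_paths (sd L) V"
  proof
    fix s assume "s \<in> gradient_paths L F"
    then obtain u \<alpha> where u: "s = u @ [\<alpha>]" "u \<in> stems L F" "facet \<alpha> (last u)" "\<alpha> \<in> critical L F"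
      unfolding grL by blast
    let ?y = "crit_flag L Ord \<alpha>"
    note c = crit_flag_critical[OF u(4)]
    note y = critical_sd_fieldD(3,4)[OF c(1)]
    have "last u \<in> L" using last_stem[OF u(2)] pair_mem unfolding critical_def by blast
    note x = insert_coface_in_sd[OF y this, unfolded c(2), OF u(3)]
    obtain w where w: "w \<in> stems (sd L) V" "last w = insert (last u) ?y" "project_path w = u"
      using lift_stem[OF acyclic_flow[OF assms] u(2) x(1,2,3)] by blast
    have "w @ [?y] \<in> gradient_paths (sd L) V"
      unfolding gradient_paths_eq_stems[OF sd_field_discrete_vector_field] using w(1,2) x(5) c(1) by auto
    moreover have "\<alpha> \<noteq> last u" using u(3) unfolding facet_def by blast
    then have "project_path (w @ [?y]) = s"
      using project_path_snoc[OF stem_nonempty[OF w(1)], of ?y] carrier_eq[OF y(1)] c(2) w(3) u(1) by simp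
    ultimately show "s \<in> project_path ` gradient_paths (sd L) V" by blast
  qed
qed

lemma gradient_path_ends:
  assumes "t \<in> gradient_paths (sd L) V"
  shows "hd t = crit_flag L Ord (hd (project_path t))" and "last t = crit_flag L Ord (last (project_path t))"
proof -
  have ne: "t \<noteq> []" and ends: "hd t \<in> critical (sd L) V" "last t \<in> critical (sd L) V"
    using assms unfolding gradient_paths_def is_path_def by auto
  note h = critical_sd_fieldD[OF ends(1)] and l = critical_sd_fieldD[OF ends(2)]
  show "hd t = crit_flag L Ord (hd (project_path t))"
    using h(2) hd_project_path[OF ne] carrier_eq[OF h(3)] by simp
  show "last t = crit_flag L Ord (last (project_path t))"
    using l(2) last_project_path[OF ne] carrier_eq[OF l(3)] by simp
qed

end

theorem theorem1p1:
  fixes L :: "'v set set" and F :: "('v set \<times> 'v set) set" and Ord :: "'v set \<Rightarrow> 'v list"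
  assumes "simplicial_complex L"
    and "discrete_morse L F"
    and "\<forall>\<alpha>\<in>critical L F. is_ordering \<alpha> (Ord \<alpha>)"
  shows "(discrete_morse (sd L) (sd_field L F Ord)) \<and>
     ((\<forall>\<alpha>\<in>critical L F. crit_flag L Ord \<alpha> \<in> sd L \<and>
              label (crit_flag L Ord \<alpha>) = singletons (Ord \<alpha>)) \<and>
           critical (sd L) (sd_field L F Ord) = crit_flag L Ord ` critical L F) \<and>
     (\<forall>\<alpha>\<in>critical L F.
             {\<gamma> \<in> critical (sd L) (sd_field L F Ord). sdim \<gamma> = sdim \<alpha> \<and> carrier_simplex \<gamma> \<subseteq> \<alpha>}
               = {crit_flag L Ord \<alpha>}) \<and>
     (\<forall>c. (\<forall>\<alpha>\<in>critical L F. c \<alpha> \<in> sd L \<and> sdim (c \<alpha>) = sdim \<alpha> \<and> carrier_simplex (c \<alpha>) \<subseteq> \<alpha>) \<longrightarrow>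
             (\<exists>Ord'. (\<forall>\<alpha>\<in>critical L F. is_ordering \<alpha> (Ord' \<alpha>)) \<and>
                (\<forall>\<alpha>\<in>critical L F. crit_flag L Ord' \<alpha> = c \<alpha>) \<and>
                critical (sd L) (sd_field L F Ord') = c ` critical L F)) \<and>
     (bij_betw (crit_flag L Ord) (critical L F) (critical (sd L) (sd_field L F Ord))) \<and>
     (\<exists>\<Phi>. bij_betw \<Phi> (gradient_paths L F) (gradient_paths (sd L) (sd_field L F Ord)) \<and>
             (\<forall>s\<in>gradient_paths L F.
                hd (\<Phi> s) = crit_flag L Ord (hd s) \<and> last (\<Phi> s) = crit_flag L Ord (last s)) \<and>
             (\<forall>t\<in>gradient_paths (sd L) (sd_field L F Ord).
                the_inv_into (gradient_paths L F) \<Phi> t = project_path t))"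
proof -
  have dvf: "discrete_vector_field L F" using assms(2) unfolding discrete_morse_def by blast
  interpret vector_field_with_orderings L F Ord
    using assms(1,3) dvf by unfold_locales simp_all
  let ?G = "gradient_paths L F" and ?G' = "gradient_paths (sd L) (sd_field L F Ord)"
  \<comment> \<open>Projecting is the map with a canonical description; the required bijection is its inverse.\<close>
  define \<Phi> where "\<Phi> = the_inv_into ?G' project_path"
  note bij = project_path_bij[OF assms(2)]
  have inj: "inj_on project_path ?G'" using bij unfolding bij_betw_def by blast
  have \<Phi>: "bij_betw \<Phi> ?G ?G'" unfolding \<Phi>_def using bij by (rule bij_betw_the_inv_into)
  have inv: "project_path (\<Phi> s) = s" if "s \<in> ?G" for s
    unfolding \<Phi>_def using f_the_inv_into_f_bij_betw[OF bij] that by simp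
  have ends: "\<forall>s\<in>?G. hd (\<Phi> s) = crit_flag L Ord (hd s) \<and> last (\<Phi> s) = crit_flag L Ord (last s)"
  proof
    fix s assume s: "s \<in> ?G"
    then have "\<Phi> s \<in> ?G'" using \<Phi> by (rule bij_betwE[rule_format, rotated])
    from gradient_path_ends[OF this]
    show "hd (\<Phi> s) = crit_flag L Ord (hd s) \<and> last (\<Phi> s) = crit_flag L Ord (last s)"
      unfolding inv[OF s] by blast
  qed
  have the_inv: "\<forall>t\<in>?G'. the_inv_into ?G \<Phi> t = project_path t"
  proof
    fix t assume t: "t \<in> ?G'"
    have "project_path t \<in> ?G" using bij t by (rule bij_betwE[rule_format])
    moreover have "\<Phi> (project_path t) = t" unfolding \<Phi>_def by (rule the_inv_into_f_f[OF inj t])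
    ultimately show "the_inv_into ?G \<Phi> t = project_path t"
      using the_inv_into_f_eq \<Phi> unfolding bij_betw_def by metis
  qed
  \<comment> \<open>A simplex of top dimension is the flag of an ordering, which is read off from its label.\<close>
  have any_flag: "\<exists>Ord'. (\<forall>\<alpha>\<in>critical L F. is_ordering \<alpha> (Ord' \<alpha>)) \<and>
      (\<forall>\<alpha>\<in>critical L F. crit_flag L Ord' \<alpha> = c \<alpha>) \<and>
      critical (sd L) (sd_field L F Ord') = c ` critical L F"
    if c: "\<forall>\<alpha>\<in>critical L F. c \<alpha> \<in> sd L \<and> sdim (c \<alpha>) = sdim \<alpha> \<and> carrier_simplex (c \<alpha>) \<subseteq> \<alpha>" for c
  proof -
    have "\<exists>vs. distinct vs \<and> set vs = \<alpha> \<and> flag vs = c \<alpha>" if \<alpha>: "\<alpha> \<in> critical L F" for \<alpha>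
    proof -
      have \<gamma>: "c \<alpha> \<in> sd L" "sdim (c \<alpha>) = sdim \<alpha>" "\<Union>(c \<alpha>) \<subseteq> \<alpha>"
        using c \<alpha> carrier_eq[of "c \<alpha>"] by auto
      note f = full_carrier_eq[OF ord(4)[OF \<alpha>] \<gamma>]
      obtain vs where "distinct vs" "set vs = \<Union>(c \<alpha>)" "flag vs = c \<alpha>"
        using full_is_flag[OF complex \<gamma>(1) f(2)] by blast
      then show ?thesis using f(1) by auto
    qed
    then obtain Ord' where O: "\<And>\<alpha>. \<alpha> \<in> critical L F \<Longrightarrow>
        distinct (Ord' \<alpha>) \<and> set (Ord' \<alpha>) = \<alpha> \<and> flag (Ord' \<alpha>) = c \<alpha>"
      by metis
    interpret O: vector_field_with_orderings L F Ord'
      by unfold_locales (use assms(1) dvf O in \<open>simp_all add: is_ordering_def\<close>)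
    have "\<forall>\<alpha>\<in>critical L F. crit_flag L Ord' \<alpha> = c \<alpha>"
      using O.crit_flag_eq_flag(1) O by simp
    moreover from this have "critical (sd L) (sd_field L F Ord') = c ` critical L F"
      unfolding O.critical_sd_field_eq_image by (intro image_cong) simp_all
    moreover have "\<forall>\<alpha>\<in>critical L F. is_ordering \<alpha> (Ord' \<alpha>)" using O by (simp add: is_ordering_def)
    ultimately show ?thesis by blast
  qed
  have flags: "\<forall>\<alpha>\<in>critical L F. crit_flag L Ord \<alpha> \<in> sd L \<and>
      label (crit_flag L Ord \<alpha>) = singletons (Ord \<alpha>)"
    using crit_flag_eq_flag(1-3) by simp
  show ?thesis
    using discrete_morse_sd_field[OF assms(2)] flags critical_sd_field_eq_image critical_simplex_in
      any_flag crit_flag_bij \<Phi> ends the_inv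
    by (intro conjI exI[of _ \<Phi>] ballI allI impI) simp_all
qed

end
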